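(* Define polynomials in $x$: $b_0=-x^5$, $b_1=1+5x+5x^2+5x^3+5x^4-16x^5$, $b_2=-4-15x+10x^2+35x^3+60x^4-96x^5$, $b_3=6+15x-35x^2+40x^3+240x^4-256x^5$, $b_4=-4-5x+20x^2-80x^3+320x^4-256x^5$, and write $b_k(\tau)$ for $b_k$ evaluated at $x=x(\tau)$. Then \[ x(\tau)^5+\sum_{k=0}^4 b_k(5\tau)\,x(\tau)^k=0. \]
   Context: $q=e^{2\pi i\tau}$ with $\tau$ in the upper half-plane, and $x(\tau)=\prod_{m\ge1}\frac{(1-q^{2m})^5(1-q^{5m})}{(1-q^m)^5(1-q^{10m})}$. (One has $x=1+5y$ with $y(\tau)=q\prod_{m\ge1}\frac{(1-q^{2m})(1-q^{10m})^3}{(1-q^m)^3(1-q^{5m})}$.) *)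

theory Defs
  imports "HOL-Analysis.Analysis" "HOL-Computational_Algebra.Polynomial"
begin

definition nome :: "complex \<Rightarrow> complex" where
  "nome \<tau> = exp (2 * of_real pi * \<i> * \<tau>)"

text \<open>\<^const>\<open>prodinf\<close> starts at \<open>0\<close>, so the product over \<open>m \<ge> 1\<close> is indexed by \<open>Suc m\<close>.\<close>

definition xfun :: "complex \<Rightarrow> complex" where
  "xfun \<tau> = (let q = nome \<tau> in
     (\<Prod>m. ((1 - q ^ (2 * Suc m)) ^ 5 * (1 - q ^ (5 * Suc m))) /
           ((1 - q ^ Suc m) ^ 5 * (1 - q ^ (10 * Suc m)))))"

text \<open>Coefficients in ascending order; only the indices \<open>k \<le> 4\<close> are meaningful.\<close>

definition bpoly :: "nat \<Rightarrow> complex poly" where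
  "bpoly k =
     [[:0, 0, 0, 0, 0, -1:],
      [:1, 5, 5, 5, 5, -16:],
      [:-4, -15, 10, 35, 60, -96:],
      [:6, 15, -35, 40, 240, -256:],
      [:-4, -5, 20, -80, 320, -256:]] ! k"

end

theory Submission
  imports Defs "HOL-Library.Nat_Bijection" "HOL-Real_Asymp.Real_Asymp"
begin

text \<open>
  Let \<open>\<theta>(q) = (\<Sum>n. (-1)\<^sup>n q\<^bsup>n\<^sup>2\<^esup>) = E(q)\<^sup>2 / E(q\<^sup>2)\<close> with \<open>E(q) = (\<Prod>n\<ge>1. 1 - q\<^sup>n)\<close>, and put
  \<open>a = \<theta>(q)\<close>, \<open>b = \<theta>(q\<^sup>5)\<close>, \<open>c = \<theta>(q\<^bsup>25\<^esup>)\<close>. Sorting the exponents of \<open>a\<close> by \<open>n mod 5\<close> gives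
  \<open>a = c + \<alpha> + \<beta>\<close>, where \<open>\<alpha>\<close> and \<open>\<beta>\<close> pick up the factors \<open>\<zeta>\<close> and \<open>\<zeta>\<^sup>4\<close> under \<open>q \<mapsto> \<zeta>q\<close> for
  a fifth root of unity \<open>\<zeta>\<close>. The factorisation \<open>5 = (2 + \<i>)(2 - \<i>)\<close> of the form \<open>m\<^sup>2 + n\<^sup>2\<close> yields
  \<open>b\<^sup>2 = c\<^sup>2 + \<alpha>\<beta>\<close>, and the product formula for \<open>\<theta>\<close> yields
  \<open>c (\<Prod>j<5. c + \<zeta>\<^sup>j\<alpha> + \<zeta>\<^bsup>4j\<^esup>\<beta>) = b\<^sup>6\<close>. Eliminating \<open>\<alpha>\<close> and \<open>\<beta>\<close> leaves a relation between \<open>a\<close>,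
  \<open>b\<close>, \<open>c\<close>, which is the claim because \<open>4x(\<tau>) + 1 = 5b\<^sup>2/a\<^sup>2\<close> and \<open>4x(5\<tau>) + 1 = 5c\<^sup>2/b\<^sup>2\<close>. These two
  formulas come from the dissection \<open>b\<^sup>2 = c\<^sup>2 + \<alpha>\<beta>\<close> and its analogue for \<open>(\<Sum>n odd. q\<^bsup>n\<^sup>2\<^esup>)\<close>, with
  \<open>\<alpha>\<beta>\<close> evaluated by the Jacobi triple product.
\<close>

section \<open>Infinite products\<close>

text \<open>The infinite q-Pochhammer symbol (z; q). Its exponents start at 0, so the Euler product
  over n \<ge> 1 is the case z = q.\<close>

definition qpoch :: "complex \<Rightarrow> complex \<Rightarrow> complex" where
  "qpoch z q = (\<Prod>n. 1 - z * q ^ n)"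

definition euler :: "complex \<Rightarrow> complex" where
  "euler q = qpoch q q"

lemma convergent_prod_qpoch:
  assumes "norm (q :: complex) < 1"
  shows "convergent_prod (\<lambda>n. 1 - z * q ^ n)"
proof -
  have "summable (\<lambda>n. norm z * norm q ^ n)"
    using assms by (intro summable_mult summable_geometric) auto
  hence "abs_convergent_prod (\<lambda>n. 1 - z * q ^ n)"
    by (intro summable_imp_abs_convergent_prod) (simp add: norm_mult norm_power)
  thus ?thesis by (rule abs_convergent_prod_imp_convergent_prod)
qed

lemma has_prod_qpoch:
  assumes "norm (q :: complex) < 1"
  shows "(\<lambda>n. 1 - z * q ^ n) has_prod qpoch z q"
  unfolding qpoch_def by (rule convergent_prod_has_prod[OF convergent_prod_qpoch[OF assms]])

lemma qpoch_limit:
  assumes "norm (q :: complex) < 1"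
  shows "(\<lambda>N. \<Prod>n<N. 1 - z * q ^ n) \<longlonglongrightarrow> qpoch z q"
  using has_prod_imp_tendsto'[OF has_prod_qpoch[OF assms]] .

lemma qpoch_nonzero:
  assumes "norm (q :: complex) < 1" "\<And>n. z * q ^ n \<noteq> 1"
  shows "qpoch z q \<noteq> 0"
  unfolding qpoch_def by (rule prodinf_nonzero) (use assms convergent_prod_qpoch in auto)

lemma power_ne_one:
  assumes "norm (q :: complex) < 1" "n > 0"
  shows "q ^ n \<noteq> 1"
proof
  assume "q ^ n = 1"
  hence "norm q ^ n = 1" by (simp flip: norm_power)
  moreover have "norm q ^ n < 1" using assms by (simp add: power_less_one_iff)
  ultimately show False by simp
qed

lemma euler_nonzero:
  assumes "norm q < 1"
  shows "euler q \<noteq> 0"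
proof -
  have "q * q ^ n \<noteq> 1" for n
    using power_ne_one[OF assms, of "Suc n"] by simp
  thus ?thesis unfolding euler_def using assms by (intro qpoch_nonzero)
qed

text \<open>Sort the exponents by residue mod k. For partial products of length \<open>N * k\<close>
  this is a regrouping into blocks of k factors, and these lengths form a subsequence.\<close>

lemma qpoch_split:
  assumes "norm q < 1" "k > 0"
  shows "qpoch z q = (\<Prod>i<k. qpoch (z * q ^ i) (q ^ k))"
proof -
  have q': "norm (q ^ k) < 1" using assms by (simp add: norm_power power_less_one_iff)
  have "(\<Prod>n<N * k. 1 - z * q ^ n) = (\<Prod>i<k. \<Prod>n<N. 1 - z * q ^ i * (q ^ k) ^ n)" for N
  proof -
    have "(\<Prod>n<N * k. 1 - z * q ^ n) = (\<Prod>n<N. \<Prod>i\<in>{n*k..<n*k+k}. 1 - z * q ^ i)"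
      by (rule prod.nat_group[symmetric])
    also have "\<dots> = (\<Prod>n<N. \<Prod>i<k. 1 - z * q ^ i * (q ^ k) ^ n)"
    proof (rule prod.cong[OF refl])
      fix n
      have "(\<Prod>i\<in>{n*k..<n*k+k}. 1 - z * q ^ i) = (\<Prod>i\<in>{0..<k}. 1 - z * q ^ (i + n * k))"
        using prod.shift_bounds_nat_ivl[of "\<lambda>i. 1 - z * q ^ i" 0 "n*k" k] by (simp add: add.commute)
      thus "(\<Prod>i\<in>{n*k..<n*k+k}. 1 - z * q ^ i) = (\<Prod>i<k. 1 - z * q ^ i * (q ^ k) ^ n)"
        by (simp add: power_add power_mult mult.commute atLeast0LessThan mult.assoc flip: power_mult)
    qed
    finally show ?thesis by (simp add: prod.swap[of _ "{..<N}"])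
  qed
  moreover have "(\<lambda>N. \<Prod>n<N * k. 1 - z * q ^ n) \<longlonglongrightarrow> qpoch z q"
    using LIMSEQ_subseq_LIMSEQ[OF qpoch_limit[OF assms(1), of z], of "\<lambda>N. N * k"] assms(2)
    by (simp add: strict_mono_def o_def)
  moreover have "(\<lambda>N. \<Prod>i<k. \<Prod>n<N. 1 - z * q ^ i * (q ^ k) ^ n) \<longlonglongrightarrow> (\<Prod>i<k. qpoch (z * q ^ i) (q ^ k))"
    by (intro tendsto_prod qpoch_limit q')
  ultimately show ?thesis using LIMSEQ_unique by simp
qed

lemma qpoch_head:
  assumes "norm q < 1" "z \<noteq> 1"
  shows "qpoch z q = (1 - z) * qpoch (z * q) q"
proof -
  have "qpoch (z * q) q = (\<Prod>n. 1 - z * q ^ Suc n)"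
    by (simp add: qpoch_def mult.assoc)
  also have "\<dots> = qpoch z q / (1 - z)"
    unfolding qpoch_def using prodinf_split_head[OF convergent_prod_qpoch[OF assms(1), of z]] assms(2)
    by simp
  finally show ?thesis using assms(2) by simp
qed

lemma qpoch_mult_neg:
  assumes "norm q < 1"
  shows "qpoch z q * qpoch (- z) q = qpoch (z ^ 2) (q ^ 2)"
proof -
  have "qpoch z q * qpoch (- z) q = (\<Prod>n. (1 - z * q ^ n) * (1 - (- z) * q ^ n))"
    unfolding qpoch_def by (intro prodinf_mult convergent_prod_qpoch assms)
  also have "(\<lambda>n. (1 - z * q ^ n) * (1 - (- z) * q ^ n)) = (\<lambda>n. 1 - z ^ 2 * (q ^ 2) ^ n)"
    by (auto simp: algebra_simps power2_eq_square power_mult_distrib simp flip: power_mult power_add)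
  finally show ?thesis by (simp add: qpoch_def)
qed

section \<open>The Jacobi triple product\<close>

text \<open>The symbol (q; q) with n factors; \<open>qfac q M / (qfac q k * qfac q (M - k))\<close>
  is a Gaussian binomial coefficient.\<close>

definition qfac :: "complex \<Rightarrow> nat \<Rightarrow> complex" where
  "qfac q n = (\<Prod>k<n. 1 - q * q ^ k)"

lemma qfac_0 [simp]: "qfac q 0 = 1"
  by (simp add: qfac_def)

lemma qfac_Suc: "qfac q (Suc n) = qfac q n * (1 - q ^ Suc n)"
  by (simp add: qfac_def)

lemma qfac_nonzero: "norm q < 1 \<Longrightarrow> qfac q n \<noteq> 0"
  using power_ne_one[of q "Suc _"] by (auto simp: qfac_def)

lemma q_binomial_theorem:
  assumes "norm q < 1"
  shows "(\<Prod>j<M. 1 + z * q ^ j) =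
           (\<Sum>k\<le>M. qfac q M / (qfac q k * qfac q (M - k)) * q ^ (k * (k - 1) div 2) * z ^ k)"
proof (induction M)
  case 0
  show ?case by (simp add: qfac_def)
next
  case (Suc M)
  note nz = qfac_nonzero[OF assms] 
  define c where "c = (\<lambda>M k. if k \<le> M then qfac q M / (qfac q k * qfac q (M - k)) else 0)"
  define t where "t = (\<lambda>k::nat. q ^ (k * (k - 1) div 2))"
  have tri: "t (Suc k) = t k * q ^ k" for k
  proof -
    have "Suc k * (Suc k - 1) = k * (k - 1) + 2 * k" by (cases k) auto
    hence "Suc k * (Suc k - 1) div 2 = k * (k - 1) div 2 + k" by simp
    thus ?thesis by (simp add: t_def power_add)
  qed
  \<comment> \<open>Of the two q-Pascal rules, the one with weight \<open>q ^ (M - k)\<close> is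
    used: with the \<open>q ^ k\<close> from \<open>tri\<close> it produces the \<open>q ^ M\<close>
    of the new factor. Since \<open>c\<close> is 0 beyond M, the case k = M is included.\<close>
  have pascal: "c (Suc M) (Suc k) = c M (Suc k) + q ^ (M - k) * c M k" if "k \<le> M" for k
  proof (cases "k = M")
    case True
    thus ?thesis by (simp add: c_def nz)
  next
    case False
    then obtain d where M: "M = Suc (k + d)" using less_imp_Suc_add[of k M] False \<open>k \<le> M\<close> by force
    \<comment> \<open>In terms of x and y the rule is 1 - xy = (1 - y) + y (1 - x).\<close>
    define x y where "x = q ^ Suc k" and "y = q ^ Suc d"
    have ne: "1 - x \<noteq> 0" "1 - y \<noteq> 0"
      using power_ne_one[OF assms, of "Suc k"] power_ne_one[OF assms, of "Suc d"]
      by (auto simp: x_def y_def)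
    have diffs: "Suc M - Suc k = Suc d" "M - Suc k = d" "M - k = Suc d" "Suc k \<le> Suc M" "Suc k \<le> M" "k \<le> M"
      using M by auto
    have "q ^ Suc M = x * y" by (simp add: M x_def y_def power_add)
    hence "qfac q (Suc M) = qfac q M * (1 - x * y)" by (simp only: qfac_Suc)
    moreover have "qfac q (Suc k) = qfac q k * (1 - x)" by (simp only: qfac_Suc x_def)
    moreover have "qfac q (Suc d) = qfac q d * (1 - y)" by (simp only: qfac_Suc y_def)
    moreover have "A * (1 - x * y) / (a * (1 - x) * (b * (1 - y))) =
        A / (a * (1 - x) * b) + y * (A / (a * (b * (1 - y))))" if "a \<noteq> 0" "b \<noteq> 0" for A a b
      using that ne by (simp add: divide_simps) (simp add: algebra_simps)
    ultimately show ?thesis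
      unfolding c_def y_def[symmetric] by (simp only: diffs if_True nz not_False_eq_True y_def[symmetric])
  qed
  have c0: "c M 0 = 1" for M using nz by (simp add: c_def qfac_def)
  have cM: "c M (Suc M) = 0" by (simp add: c_def)
  have IH: "(\<Prod>j<M. 1 + z * q ^ j) = (\<Sum>k\<le>M. c M k * t k * z ^ k)"
    using Suc by (simp add: c_def t_def)
  have "(\<Sum>k\<le>Suc M. c (Suc M) k * t k * z ^ k) =
          1 + (\<Sum>k\<le>M. c (Suc M) (Suc k) * t (Suc k) * z ^ Suc k)"
    by (subst sum.atMost_Suc_shift) (simp add: c0 t_def)
  also have "(\<Sum>k\<le>M. c (Suc M) (Suc k) * t (Suc k) * z ^ Suc k) =
      (\<Sum>k\<le>M. c M (Suc k) * t (Suc k) * z ^ Suc k + z * q ^ M * (c M k * t k * z ^ k))"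
  proof (rule sum.cong[OF refl])
    fix k assume "k \<in> {..M}"
    hence "q ^ (M - k) * q ^ k = q ^ M" by (simp flip: power_add)
    hence "q ^ (M - k) * c M k * t (Suc k) * z ^ Suc k = z * q ^ M * (c M k * t k * z ^ k)"
      unfolding tri by (simp add: algebra_simps)
    thus "c (Suc M) (Suc k) * t (Suc k) * z ^ Suc k =
            c M (Suc k) * t (Suc k) * z ^ Suc k + z * q ^ M * (c M k * t k * z ^ k)"
      using pascal[of k] \<open>k \<in> {..M}\<close> by (simp add: algebra_simps)
  qed
  also have "1 + \<dots> = (1 + (\<Sum>k\<le>M. c M (Suc k) * t (Suc k) * z ^ Suc k)) +
                z * q ^ M * (\<Sum>k\<le>M. c M k * t k * z ^ k)"
    by (simp add: sum.distrib sum_distrib_left)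
  also have "1 + (\<Sum>k\<le>M. c M (Suc k) * t (Suc k) * z ^ Suc k) = (\<Sum>k\<le>Suc M. c M k * t k * z ^ k)"
    by (subst sum.atMost_Suc_shift) (simp add: c0 t_def)
  also have "\<dots> = (\<Sum>k\<le>M. c M k * t k * z ^ k)" by (simp add: cM)
  finally have "(\<Sum>k\<le>Suc M. c (Suc M) k * t k * z ^ k) = (\<Prod>j<Suc M. 1 + z * q ^ j)"
    by (simp add: IH algebra_simps)
  thus ?case by (simp add: c_def t_def)
qed

text \<open>The q-binomial theorem in base \<open>q ^ 2\<close> with 2N factors, centred by the
  choice of \<open>z\<close>. The first N factors, in reverse order, become the factors in 1/w once
  \<open>F N\<close> is pulled out; completing the square in the exponent on the other side releases
  the same \<open>F N\<close>, which cancels.\<close>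

lemma finite_jacobi_triple_product:
  assumes "norm q < 1" "q \<noteq> 0" "w \<noteq> 0"
  shows "(\<Prod>i<N. (1 + w * q ^ (2 * i + 1)) * (1 + q ^ (2 * i + 1) / w)) =
    (\<Sum>k\<le>2 * N. qfac (q ^ 2) (2 * N) / (qfac (q ^ 2) k * qfac (q ^ 2) (2 * N - k)) *
       (q powi ((int k - int N) ^ 2) * w powi (int k - int N)))"
    (is "?L = (\<Sum>k\<le>_. ?c k * ?t k)")
proof -
  define z where "z = w * q powi (1 - 2 * int N)"
  define F where "F = (\<lambda>N. w ^ N * q powi (- (int N ^ 2)))"
  have q2: "norm (q ^ 2) < 1" using assms by (simp add: norm_power power_less_one_iff)
  have add: "q powi (m + n) = q powi m * q powi n" for m n
    using assms by (simp add: power_int_add)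
  have split: "(\<Prod>j<N + M. f j) = (\<Prod>j<N. f j) * (\<Prod>j<M. f (N + j))" for f :: "nat \<Rightarrow> complex" and M
    by (induction M) (auto simp: mult.assoc)
  have F: "(\<Prod>i<N. w * q powi (- 1 - 2 * int i)) = F N" for N
  proof (induction N)
    case (Suc N)
    have "- (int (Suc N) ^ 2) = - (int N ^ 2) + (- 1 - 2 * int N)"
      by (simp add: power2_eq_square algebra_simps)
    hence "q powi (- (int (Suc N) ^ 2)) = q powi (- (int N ^ 2)) * q powi (- 1 - 2 * int N)"
      by (simp only: add)
    thus ?case using Suc by (simp add: F_def)
  qed (simp add: F_def)
  have low: "1 + z * (q ^ 2) ^ (N - Suc i) =
      (w * q powi (- 1 - 2 * int i)) * (1 + q ^ (2 * i + 1) / w)" if "i < N" for i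
  proof -
    have "2 * int N - 2 - 2 * int i = int (2 * (N - Suc i))"
      using that by (simp add: of_nat_diff)
    hence "(q ^ 2) ^ (N - Suc i) = q powi (2 * int N - 2 - 2 * int i)"
      by (simp only: power_int_of_nat power_mult)
    hence "z * (q ^ 2) ^ (N - Suc i) = w * q powi (1 - 2 * int N + (2 * int N - 2 - 2 * int i))"
      unfolding z_def by (simp only: add mult.assoc)
    also have "1 - 2 * int N + (2 * int N - 2 - 2 * int i) = - 1 - 2 * int i" by simp
    finally have "z * (q ^ 2) ^ (N - Suc i) = w * q powi (- 1 - 2 * int i)" .
    moreover have "q powi (- 1 - 2 * int i) * q powi (int (2 * i + 1)) = 1"
      by (subst add[symmetric]) simp
    hence "q powi (- 1 - 2 * int i) * q ^ (2 * i + 1) = 1" by (simp only: power_int_of_nat)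
    ultimately show ?thesis using assms(3) by (simp add: distrib_left)
  qed
  have high: "1 + z * (q ^ 2) ^ (N + i) = 1 + w * q ^ (2 * i + 1)" for i
  proof -
    have "2 * int N + 2 * int i = int (2 * (N + i))" by simp
    hence "(q ^ 2) ^ (N + i) = q powi (2 * int N + 2 * int i)"
      by (simp only: power_int_of_nat power_mult)
    hence "z * (q ^ 2) ^ (N + i) = w * q powi (1 - 2 * int N + (2 * int N + 2 * int i))"
      unfolding z_def by (simp only: add mult.assoc)
    also have "1 - 2 * int N + (2 * int N + 2 * int i) = int (2 * i + 1)" by simp
    finally show ?thesis by (simp only: power_int_of_nat)
  qed
  have "(\<Prod>j<2 * N. 1 + z * (q ^ 2) ^ j) =
          (\<Prod>j<N. 1 + z * (q ^ 2) ^ j) * (\<Prod>j<N. 1 + z * (q ^ 2) ^ (N + j))"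
    using split[of "\<lambda>j. 1 + z * (q ^ 2) ^ j" N] by (simp add: mult_2)
  also have "(\<Prod>j<N. 1 + z * (q ^ 2) ^ j) = (\<Prod>i<N. 1 + z * (q ^ 2) ^ (N - Suc i))"
    by (rule prod.nat_diff_reindex[symmetric])
  also have "\<dots> = F N * (\<Prod>i<N. 1 + q ^ (2 * i + 1) / w)"
    unfolding F[symmetric] prod.distrib[symmetric] by (intro prod.cong refl low) simp
  finally have L: "(\<Prod>j<2 * N. 1 + z * (q ^ 2) ^ j) = F N * ?L"
    by (simp add: high prod.distrib)
  have R: "(q ^ 2) ^ (k * (k - 1) div 2) * z ^ k = F N * ?t k" for k
  proof -
    have "(q ^ 2) ^ (k * (k - 1) div 2) = q ^ (k * (k - 1))"
    proof -
      have "2 * (k * (k - 1) div 2) = k * (k - 1)" by (cases k) auto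
      thus ?thesis by (simp only: flip: power_mult)
    qed
    also have "\<dots> = q powi (int k ^ 2 - int k)"
    proof -
      have "int k ^ 2 - int k = int (k * (k - 1))"
        by (cases k) (auto simp: power2_eq_square algebra_simps)
      thus ?thesis by (simp only: power_int_of_nat)
    qed
    finally have "(q ^ 2) ^ (k * (k - 1) div 2) * z ^ k =
        w ^ k * q powi (int k ^ 2 - int k + (1 - 2 * int N) * int k)"
      by (simp add: z_def power_mult_distrib add power_int_mult)
    also have "int k ^ 2 - int k + (1 - 2 * int N) * int k = - (int N ^ 2) + (int k - int N) ^ 2"
      by (simp add: power2_eq_square algebra_simps)
    also have "w ^ k = w ^ N * w powi (int k - int N)"
      using assms by (simp add: power_int_diff)
    finally show ?thesis by (simp only: F_def add mult_ac)
  qed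
  have "F N \<noteq> 0" using assms by (simp add: F_def)
  moreover have "F N * ?L = F N * (\<Sum>k\<le>2 * N. ?c k * ?t k)"
  proof -
    have "F N * ?L = (\<Sum>k\<le>2 * N. ?c k * ((q ^ 2) ^ (k * (k - 1) div 2) * z ^ k))"
      unfolding L[symmetric] q_binomial_theorem[OF q2] by (simp add: mult.assoc)
    also have "\<dots> = (\<Sum>k\<le>2 * N. F N * (?c k * ?t k))"
      by (rule sum.cong[OF refl]) (simp only: R mult.left_commute[of _ "F N"])
    finally show ?thesis by (simp only: sum_distrib_left)
  qed
  ultimately show ?thesis by simp
qed

section \<open>Convergence and passage from the finite to the infinite triple product\<close>

text \<open>The term is the n-th power of \<open>r ^ n * s\<close>, which tends to 0, so a geometric
  series of ratio 1/2 eventually dominates.\<close>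

lemma summable_power_square:
  fixes r s :: real
  assumes "0 \<le> r" "r < 1" "0 \<le> s"
  shows "summable (\<lambda>n. r ^ (n ^ 2) * s ^ n)"
proof (rule summable_comparison_test_ev)
  have "(\<lambda>n. r ^ n * s) \<longlonglongrightarrow> 0 * s"
    using assms by (intro tendsto_mult LIMSEQ_realpow_zero tendsto_const) auto
  hence "eventually (\<lambda>n. r ^ n * s < 1 / 2) sequentially"
    by (intro order_tendstoD) auto
  thus "eventually (\<lambda>n. norm (r ^ (n ^ 2) * s ^ n) \<le> (1 / 2) ^ n) sequentially"
  proof eventually_elim
    case (elim n)
    have "r ^ (n ^ 2) * s ^ n = (r ^ n * s) ^ n"
      by (simp add: power2_eq_square power_mult power_mult_distrib)
    also have "\<dots> \<le> (1 / 2) ^ n" using elim assms by (intro power_mono) auto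
    finally show ?case using assms by simp
  qed
  show "summable (\<lambda>n. (1 / 2 :: real) ^ n)" by (rule summable_geometric) auto
qed

lemma summable_on_int_theta:
  fixes r s :: real
  assumes "0 \<le> r" "r < 1" "0 < s"
  shows "(\<lambda>n. r powi (n ^ 2) * s powi n) summable_on (UNIV :: int set)"
proof -
  have *: "(\<lambda>n. r ^ (n ^ 2) * t ^ n) summable_on UNIV" if "t > 0" for t
    using summable_power_square[of r t] assms that by (simp add: summable_on_UNIV_nonneg_real_iff)
  have "((\<lambda>n. r powi (n ^ 2) * s powi n) summable_on (range int)) \<longleftrightarrow>
        ((\<lambda>n. r ^ (n ^ 2) * s ^ n) summable_on UNIV)"
    by (subst summable_on_reindex) (auto simp: o_def simp flip: of_nat_power)
  moreover have "((\<lambda>n. r powi (n ^ 2) * s powi n) summable_on (range (\<lambda>n. - int n))) \<longleftrightarrow>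
        ((\<lambda>n. r ^ (n ^ 2) * inverse s ^ n) summable_on UNIV)"
    by (subst summable_on_reindex)
       (auto simp: o_def inj_on_def power_int_minus power_inverse simp flip: of_nat_power)
  ultimately have "(\<lambda>n. r powi (n ^ 2) * s powi n) summable_on (range int \<union> range (\<lambda>n. - int n))"
    using * assms by (intro summable_on_union) auto
  also have "range int \<union> range (\<lambda>n. - int n) = UNIV"
  proof -
    have "n \<in> range int \<union> range (\<lambda>n. - int n)" for n
      by (cases n rule: int_cases2) auto
    thus ?thesis by auto
  qed
  finally show ?thesis .
qed

text \<open>Let N tend to infinity in the finite identity. The coefficients are uniformly bounded
  and each tends to 1/E with E = \<open>euler (q ^ 2)\<close>, so Tannery's theorem exchanges limit
  and sum; multiplication by E finishes.\<close>

theorem jacobi_triple_product: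
  assumes q: "norm q < 1" "q \<noteq> 0" and w: "w \<noteq> 0"
  shows "((\<lambda>n. q powi (n ^ 2) * w powi n) has_sum
           (qpoch (q ^ 2) (q ^ 2) * qpoch (- w * q) (q ^ 2) * qpoch (- q / w) (q ^ 2))) UNIV"
proof -
  define p where "p = q ^ 2"
  have p: "norm p < 1" using q by (simp add: p_def norm_power power_less_one_iff)
  define t where "t = (\<lambda>n. q powi (n ^ 2) * w powi n)"
  define E where "E = qpoch p p"
  have E: "E \<noteq> 0" using euler_nonzero[OF p] by (simp add: E_def euler_def)
  have lim: "qfac p \<longlonglongrightarrow> E" using qpoch_limit[OF p, of p] by (simp add: qfac_def[abs_def] E_def)
  have liminv: "(\<lambda>n. inverse (qfac p n)) \<longlonglongrightarrow> inverse E"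
    by (intro tendsto_inverse lim E)
  obtain B where B: "\<And>n. norm (qfac p n) \<le> B"
    using convergent_imp_Bseq[of "qfac p"] lim by (auto simp: convergent_def Bseq_def)
  obtain C where C: "\<And>n. norm (inverse (qfac p n)) \<le> C"
    using convergent_imp_Bseq[of "\<lambda>n. inverse (qfac p n)"] liminv by (auto simp: convergent_def Bseq_def)
  have B0: "B \<ge> 0" and C0: "C \<ge> 0" 
    using order_trans[OF norm_ge_zero B[of 0]] order_trans[OF norm_ge_zero C[of 0]] by auto
  \<comment> \<open>The Gaussian binomial at k = N + n, set to 0 for |n| > N so that every finite
    sum becomes a sum over all integers.\<close>
  define c where "c = (\<lambda>N n. if \<bar>n\<bar> \<le> int N then
     qfac p (2 * N) * inverse (qfac p (nat (int N + n))) * inverse (qfac p (nat (int N - n))) else 0)"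
  have bound: "norm (c N n) \<le> B * C * C" for N n
  proof -
    have "norm (qfac p a * inverse (qfac p b) * inverse (qfac p d)) \<le> B * C * C" for a b d
      unfolding norm_mult by (intro mult_mono B C B0 C0 mult_nonneg_nonneg norm_ge_zero)
    thus ?thesis using B0 C0 by (simp add: c_def)
  qed
  have climit: "(\<lambda>N. c N n) \<longlonglongrightarrow> inverse E" for n
  proof -
    have 1: "filterlim (\<lambda>N::nat. 2 * N) sequentially sequentially"
            "filterlim (\<lambda>N. nat (int N + n)) sequentially sequentially"
            "filterlim (\<lambda>N. nat (int N - n)) sequentially sequentially"
      by real_asymp+
    have "(\<lambda>N. qfac p (2 * N) * inverse (qfac p (nat (int N + n))) * inverse (qfac p (nat (int N - n))))
            \<longlonglongrightarrow> E * inverse E * inverse E"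
      by (intro tendsto_mult filterlim_compose[OF lim 1(1)] filterlim_compose[OF liminv 1(2)]
            filterlim_compose[OF liminv 1(3)])
    moreover have "eventually (\<lambda>N. \<bar>n\<bar> \<le> int N) sequentially"
      using eventually_ge_at_top[of "nat \<bar>n\<bar>"] by eventually_elim auto
    hence "eventually (\<lambda>N. qfac p (2 * N) * inverse (qfac p (nat (int N + n))) *
              inverse (qfac p (nat (int N - n))) = c N n) sequentially"
      by eventually_elim (auto simp: c_def)
    ultimately show ?thesis using E by (simp add: tendsto_cong)
  qed
  have sm: "(\<lambda>n. norm (t n)) summable_on UNIV"
    using summable_on_int_theta[of "norm q" "norm w"] q w
    by (simp add: t_def norm_mult norm_power_int)
  have sm': "summable (\<lambda>k. B * C * C * norm (t (int_decode k)))"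
    by (intro summable_mult summable_on_imp_summable)
       (use sm summable_on_reindex_bij_betw[OF bij_int_decode, of "\<lambda>n. norm (t n)"] in simp)
  \<comment> \<open>Tannery's theorem is applied to series over the naturals, so
    \<open>int_decode\<close> enumerates the integers.\<close>
  have tan: "(\<lambda>N. \<Sum>k. c N (int_decode k) * t (int_decode k)) \<longlonglongrightarrow> (\<Sum>k. inverse E * t (int_decode k))"
  proof (rule conjunct2[OF conjunct2[OF tannerys_theorem[OF _ _ sm']]])
    show "((\<lambda>N. c N (int_decode k) * t (int_decode k)) \<longlongrightarrow> inverse E * t (int_decode k)) sequentially" for k
      by (intro tendsto_mult climit tendsto_const)
    show "\<forall>\<^sub>F (k, N) in sequentially \<times>\<^sub>F sequentially. norm (c N (int_decode k) * t (int_decode k))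
             \<le> B * C * C * norm (t (int_decode k))"
      by (intro always_eventually) (auto simp: norm_mult intro!: mult_right_mono bound)
  qed auto
  have fin: "(\<Sum>k. c N (int_decode k) * t (int_decode k)) =
               (\<Prod>i<N. 1 - (- w * q) * p ^ i) * (\<Prod>i<N. 1 - (- q / w) * p ^ i)" for N
  proof -
    have "((\<lambda>n. c N n * t n) has_sum (\<Sum>n\<in>{- int N..int N}. c N n * t n)) UNIV"
      by (rule has_sum_finite_neutralI) (auto simp: c_def)
    hence "((\<lambda>k. c N (int_decode k) * t (int_decode k)) has_sum (\<Sum>n\<in>{- int N..int N}. c N n * t n)) UNIV"
      using has_sum_reindex_bij_betw[OF bij_int_decode, of "\<lambda>n. c N n * t n"] by simp
    hence "(\<Sum>k. c N (int_decode k) * t (int_decode k)) = (\<Sum>n\<in>{- int N..int N}. c N n * t n)"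
      by (rule sums_unique[OF has_sum_imp_sums, symmetric])
    also have "\<dots> = (\<Sum>k\<le>2 * N. c N (int k - int N) * t (int k - int N))"
      by (rule sum.reindex_bij_witness[of _ "\<lambda>k. int k - int N" "\<lambda>n. nat (n + int N)"]) auto
    also have "\<dots> = (\<Sum>k\<le>2 * N. qfac (q ^ 2) (2 * N) / (qfac (q ^ 2) k * qfac (q ^ 2) (2 * N - k)) *
       (q powi ((int k - int N) ^ 2) * w powi (int k - int N)))"
    proof (rule sum.cong[OF refl])
      fix k assume "k \<in> {..2 * N}"
      hence 1: "nat (int N + (int k - int N)) = k" "nat (int N - (int k - int N)) = 2 * N - k"
        "\<bar>int k - int N\<bar> \<le> int N" by auto
      show "c N (int k - int N) * t (int k - int N) =
              qfac (q ^ 2) (2 * N) / (qfac (q ^ 2) k * qfac (q ^ 2) (2 * N - k)) *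
              (q powi ((int k - int N) ^ 2) * w powi (int k - int N))"
        by (simp only: c_def t_def p_def 1 if_True divide_inverse inverse_mult_distrib mult.assoc)
    qed
    also have "\<dots> = (\<Prod>i<N. (1 + w * q ^ (2 * i + 1)) * (1 + q ^ (2 * i + 1) / w))"
      by (rule finite_jacobi_triple_product[OF q w, symmetric])
    also have "\<dots> = (\<Prod>i<N. 1 - (- w * q) * p ^ i) * (\<Prod>i<N. 1 - (- q / w) * p ^ i)"
    proof -
      have "q ^ (2 * i + 1) = q * p ^ i" for i by (simp add: p_def power_mult)
      hence "1 + w * q ^ (2 * i + 1) = 1 - (- w * q) * p ^ i"
            "1 + q ^ (2 * i + 1) / w = 1 - (- q / w) * p ^ i" for i
        by (simp_all add: mult.assoc)
      thus ?thesis by (simp only: prod.distrib)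
    qed
    finally show ?thesis .
  qed
  have hs: "(t has_sum infsum t UNIV) UNIV"
    by (rule has_sum_infsum[OF abs_summable_summable[OF sm]])
  have "((\<lambda>k. t (int_decode k)) has_sum infsum t UNIV) UNIV"
    unfolding has_sum_reindex_bij_betw[OF bij_int_decode] by (rule hs)
  hence "((\<lambda>k. inverse E * t (int_decode k)) has_sum (inverse E * infsum t UNIV)) UNIV"
    by (rule has_sum_cmult_right)
  hence "(\<Sum>k. inverse E * t (int_decode k)) = inverse E * infsum t UNIV"
    by (rule sums_unique[OF has_sum_imp_sums, symmetric])
  moreover have "(\<Sum>k. inverse E * t (int_decode k)) = qpoch (- w * q) p * qpoch (- q / w) p"
    using tan unfolding fin by (rule LIMSEQ_unique[OF _ tendsto_mult[OF qpoch_limit[OF p] qpoch_limit[OF p]]])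
  ultimately have "inverse E * infsum t UNIV = qpoch (- w * q) p * qpoch (- q / w) p"
    by (simp only:)
  hence "E * (inverse E * infsum t UNIV) = E * qpoch (- w * q) p * qpoch (- q / w) p"
    by (simp only: mult.assoc)
  hence "infsum t UNIV = E * qpoch (- w * q) p * qpoch (- q / w) p"
    using E by (simp only: mult.assoc[symmetric] right_inverse mult_1_left not_False_eq_True)
  thus ?thesis using hs unfolding t_def E_def p_def by (simp only:)
qed

text \<open>Put q = p^A and w = \<sigma> p^B. Exponents of this shape arise when a theta series is
  restricted to an arithmetic progression; \<sigma> carries the sign.\<close>

lemma jacobi_triple_product_quadratic:
  assumes "norm p < 1" "p \<noteq> 0" "\<sigma> \<noteq> 0" "A > 0"
  shows "((\<lambda>n. \<sigma> powi n * p powi (int A * n ^ 2 + B * n)) has_sum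
           (euler (p ^ (2 * A)) * qpoch (- (\<sigma> * p powi (int A + B))) (p ^ (2 * A)) *
            qpoch (- (p powi (int A - B) / \<sigma>)) (p ^ (2 * A)))) UNIV"
proof -
  define q w where "q = p ^ A" and "w = \<sigma> * p powi B"
  have q: "norm q < 1" "q \<noteq> 0" and w: "w \<noteq> 0"
    using assms by (auto simp: q_def w_def norm_power power_less_one_iff)
  have q': "q = p powi int A" by (simp add: q_def)
  have 1: "q powi (n ^ 2) * w powi n = \<sigma> powi n * p powi (int A * n ^ 2 + B * n)" for n
    using assms(2) by (simp add: q' w_def power_int_mult_distrib power_int_add power_int_mult)
  have 2: "q ^ 2 = p ^ (2 * A)" by (simp add: q_def power_mult[symmetric] mult.commute)
  have 3: "- w * q = - (\<sigma> * p powi (int A + B))"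
    using assms(2) by (simp add: q' w_def power_int_add)
  have 4: "- q / w = - (p powi (int A - B) / \<sigma>)"
    using assms(2) by (simp add: q' w_def power_int_diff)
  show ?thesis
    using jacobi_triple_product[OF q w] unfolding 1 2 3 4 euler_def .
qed

section \<open>Quintic dissection of theta series\<close>

text \<open>For complex families summability is absolute, so the norms of the products are summable
  over \<open>A \<times> B\<close> and the double sum may be iterated.\<close>

lemma has_sum_product:
  fixes f :: "'a \<Rightarrow> complex" and g :: "'b \<Rightarrow> complex"
  assumes f: "(f has_sum a) A" and g: "(g has_sum b) B"
  shows "((\<lambda>(x, y). f x * g y) has_sum (a * b)) (A \<times> B)"
proof (rule has_sum_SigmaI)
  show "((\<lambda>y. case (x, y) of (x, y) \<Rightarrow> f x * g y) has_sum f x * b) B" for x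
    using has_sum_cmult_right[OF g] by simp
  show "((\<lambda>x. f x * b) has_sum a * b) A" by (rule has_sum_cmult_left[OF f])
  have f': "(\<lambda>x. norm (f x)) summable_on A" and g': "(\<lambda>y. norm (g y)) summable_on B"
    using f g has_sum_imp_summable summable_on_iff_abs_summable_on_complex by blast+
  have "(\<lambda>z. norm (case z of (x, y) \<Rightarrow> f x * g y)) summable_on (A \<times> B)"
    unfolding Infinite_Sum.abs_summable_on_Sigma_iff
  proof (intro conjI ballI)
    show "(\<lambda>y. norm (case (x, y) of (x, y) \<Rightarrow> f x * g y)) summable_on B" for x
      using summable_on_cmult_right[OF g', of "norm (f x)"] by (simp add: norm_mult)
    have "(\<lambda>x. norm (f x) * (\<Sum>\<^sub>\<infinity>y\<in>B. norm (g y))) summable_on A"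
      by (rule summable_on_cmult_left[OF f'])
    moreover have "(\<Sum>\<^sub>\<infinity>y\<in>B. norm (g y)) \<ge> 0" by (rule infsum_nonneg) simp
    ultimately show "(\<lambda>x. norm (\<Sum>\<^sub>\<infinity>y\<in>B. norm (case (x, y) of (x, y) \<Rightarrow> f x * g y))) summable_on A"
      by (simp add: norm_mult infsum_cmult_right')
  qed
  thus "(\<lambda>(x, y). f x * g y) summable_on A \<times> B" by (rule abs_summable_summable)
qed

section \<open>Weighted theta series compatible with multiplication by 2 + i\<close>

text \<open>This covers both weights that occur: (-1)^n and the indicator of odd n. By
  \<open>lattice\<close>, the weight \<epsilon>(m) \<epsilon>(n) of the Gaussian integer m + ni is
  preserved by multiplication by 2 + i. \<open>quintuple\<close> turns the class of 0 mod 5 into a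
  theta series again, and \<open>even\<close> identifies the classes r and -r.\<close>

locale quintic_weight =
  fixes \<epsilon> :: "int \<Rightarrow> complex"
  assumes bounded: "norm (\<epsilon> n) \<le> 1"
    and even: "\<epsilon> (- n) = \<epsilon> n"
    and quintuple: "\<epsilon> (5 * n) = \<epsilon> n"
    and lattice: "\<epsilon> (2 * m - n) * \<epsilon> (m + 2 * n) = \<epsilon> m * \<epsilon> n"
begin

definition theta :: "complex \<Rightarrow> complex" where
  "theta p = (\<Sum>\<^sub>\<infinity>n. \<epsilon> n * p powi (n ^ 2))"

definition part :: "int \<Rightarrow> complex \<Rightarrow> complex" where
  "part r p = (\<Sum>\<^sub>\<infinity>n | n mod 5 = r. \<epsilon> n * p powi (n ^ 2))"

lemma summable:
  assumes "norm p < 1" "p \<noteq> 0"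
  shows "(\<lambda>n. \<epsilon> n * p powi (n ^ 2)) summable_on A"
proof -
  have "(\<lambda>n::int. norm p powi (n ^ 2) * 1 powi n) summable_on UNIV"
    using assms by (intro summable_on_int_theta) auto
  hence "(\<lambda>n. norm p powi (n ^ 2)) summable_on A"
    by (auto intro: summable_on_subset)
  moreover have "norm (\<epsilon> n * p powi (n ^ 2)) \<le> norm p powi (n ^ 2)" for n
    using mult_right_mono[OF bounded[of n], of "norm p powi (n ^ 2)"]
    by (simp add: norm_mult norm_power_int)
  ultimately have "(\<lambda>n. norm (\<epsilon> n * p powi (n ^ 2))) summable_on A"
    by (intro Infinite_Sum.abs_summable_on_comparison_test')
  thus ?thesis by (rule abs_summable_summable)
qed

lemma has_sum_theta:
  assumes "norm p < 1" "p \<noteq> 0"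
  shows "((\<lambda>n. \<epsilon> n * p powi (n ^ 2)) has_sum theta p) UNIV"
  unfolding theta_def by (rule has_sum_infsum[OF summable[OF assms]])

lemma has_sum_part:
  assumes "norm p < 1" "p \<noteq> 0"
  shows "((\<lambda>n. \<epsilon> n * p powi (n ^ 2)) has_sum part r p) {n. n mod 5 = r}"
  unfolding part_def by (rule has_sum_infsum[OF summable[OF assms]])

lemma part_reflect:
  assumes "(r + s) mod 5 = 0" "r \<in> {0..<5}" "s \<in> {0..<5}"
  shows "part r p = part s p"
proof -
  have *: "(- n) mod 5 = s" if "n mod 5 = r" for n :: int
    using that assms by auto presburger
  have **: "(- n) mod 5 = r" if "n mod 5 = s" for n :: int
    using that assms by auto presburger
  show ?thesis unfolding part_def
    by (rule infsum_reindex_bij_witness[of _ uminus uminus]) (use * ** even in auto)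
qed

lemma has_sum_part_shift:
  assumes "norm p < 1" "p \<noteq> 0" "r \<in> {0..<5}"
  shows "((\<lambda>n. \<epsilon> (5 * n + r) * p powi ((5 * n + r) ^ 2)) has_sum part r p) UNIV"
proof -
  have "((\<lambda>n. \<epsilon> (5 * n + r) * p powi ((5 * n + r) ^ 2)) has_sum part r p) UNIV \<longleftrightarrow>
        ((\<lambda>n. \<epsilon> n * p powi (n ^ 2)) has_sum part r p) {n. n mod 5 = r}"
    by (rule has_sum_reindex_bij_witness[of _ "\<lambda>n. n div 5" "\<lambda>n. 5 * n + r"])
       (use assms(3) in auto)
  thus ?thesis using has_sum_part[OF assms(1,2)] by blast
qed

lemma part_0:
  assumes "norm p < 1" "p \<noteq> 0"
  shows "part 0 p = theta (p ^ 25)"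
proof -
  have "p powi ((5 * n + 0) ^ 2) = (p ^ 25) powi (n ^ 2)" for n
    using power_int_mult[of p 25 "n ^ 2"] by (simp add: power_mult_distrib)
  hence "((\<lambda>n. \<epsilon> n * (p ^ 25) powi (n ^ 2)) has_sum part 0 p) UNIV"
    using has_sum_part_shift[OF assms, of 0] quintuple by simp
  thus ?thesis by (simp add: theta_def infsumI)
qed

lemma residue_classes: "(\<Union>r\<in>{0..<5}. {n::int. n mod 5 = r}) = UNIV"
  by auto

lemma theta_dissection:
  assumes "norm p < 1" "p \<noteq> 0"
  shows "theta p = part 0 p + 2 * part 1 p + 2 * part 2 p"
proof -
  have "((\<lambda>n. \<epsilon> n * p powi (n ^ 2)) has_sum (\<Sum>r\<in>{0..<5}. part r p))
          (\<Union>r\<in>{0..<5}. {n. n mod 5 = r})"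
    by (intro sum_has_sum has_sum_part assms) auto
  hence "theta p = (\<Sum>r\<in>{0..<5}. part r p)"
    unfolding residue_classes using has_sum_theta[OF assms] has_sum_unique by blast
  moreover have "{0..<5::int} = {0, 1, 2, 3, 4}" by auto
  ultimately show ?thesis
    using part_reflect[of 1 4] part_reflect[of 2 3] by simp
qed

text \<open>Multiplication by \<open>2 + \<i>\<close> maps the lattice of Gaussian integers \<open>m + n\<i>\<close> onto the
  sublattice of all \<open>u + v\<i>\<close> with \<open>u \<equiv> 2v (mod 5)\<close> and multiplies norms by 5.\<close>

lemma theta_square:
  assumes "norm p < 1" "p \<noteq> 0"
  shows "theta (p ^ 5) ^ 2 = part 0 p ^ 2 + 4 * part 1 p * part 2 p"
proof -
  define G where "G = (\<lambda>(u, v). (\<epsilon> u * p powi (u ^ 2)) * (\<epsilon> v * p powi (v ^ 2)))"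
  \<comment> \<open>Written by classes, the sum over \<open>L\<close> splits into products of parts:
    r = 0 gives a square, and each other r gives \<open>part 1 p * part 2 p\<close> after
    reflection.\<close>
  define L where "L = (\<Union>r\<in>{0..<5}. {n::int. n mod 5 = 2 * r mod 5} \<times> {n. n mod 5 = r})"
  have p5: "norm (p ^ 5) < 1" "p ^ 5 \<noteq> 0"
    using assms by (auto simp: norm_power power_less_one_iff)
  have "(G has_sum (\<Sum>r\<in>{0..<5}. part (2 * r mod 5) p * part r p)) L"
    unfolding G_def L_def by (intro sum_has_sum has_sum_product has_sum_part assms) auto
  also have "(\<Sum>r\<in>{0..<5}. part (2 * r mod 5) p * part r p) = part 0 p ^ 2 + 4 * part 1 p * part 2 p"
  proof -
    have "{0..<5::int} = {0, 1, 2, 3, 4}" by auto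
    thus ?thesis using part_reflect[of 1 4] part_reflect[of 2 3]
      by (simp add: power2_eq_square algebra_simps)
  qed
  finally have 1: "(G has_sum (part 0 p ^ 2 + 4 * part 1 p * part 2 p)) L" .
  have L: "L = {(u, v). 5 dvd u - 2 * v}"
  proof -
    have "(u mod 5 = 2 * (v mod 5) mod 5) \<longleftrightarrow> 5 dvd u - 2 * v" for u v :: int
      by (simp add: mod_eq_dvd_iff mod_mult_right_eq)
    thus ?thesis by (auto simp: L_def)
  qed
  have "((\<lambda>(m, n). (\<epsilon> m * (p ^ 5) powi (m ^ 2)) * (\<epsilon> n * (p ^ 5) powi (n ^ 2))) has_sum
           (theta (p ^ 5) * theta (p ^ 5))) (UNIV \<times> UNIV)"
    by (intro has_sum_product has_sum_theta p5)
  also have "?this \<longleftrightarrow> (G has_sum (theta (p ^ 5) * theta (p ^ 5))) L"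
  \<comment> \<open>The inverse map is multiplication by (2 - i)/5; the divisions by 5 are exact on
    \<open>L\<close>.\<close>
  proof (rule has_sum_reindex_bij_witness[of _ "\<lambda>(u, v). ((2 * u + v) div 5, (2 * v - u) div 5)"
          "\<lambda>(m, n). (2 * m - n, m + 2 * n)"])
    fix x :: "int \<times> int"
    obtain m n where x: "x = (m, n)" by (cases x)
    show "(case case x of (m, n) \<Rightarrow> (2 * m - n, m + 2 * n) of
             (u, v) \<Rightarrow> ((2 * u + v) div 5, (2 * v - u) div 5)) = x"
      by (simp add: x)
    show "(case x of (m, n) \<Rightarrow> (2 * m - n, m + 2 * n)) \<in> L"
      by (simp add: x L)
    have "p powi ((2 * m - n) ^ 2) * p powi ((m + 2 * n) ^ 2) =
            p powi (5 * m ^ 2) * p powi (5 * n ^ 2)"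
      using assms(2) by (simp flip: power_int_add) (simp add: power2_eq_square algebra_simps)
    also have "\<dots> = (p ^ 5) powi (m ^ 2) * (p ^ 5) powi (n ^ 2)"
      using power_int_mult[of p 5 "m ^ 2"] power_int_mult[of p 5 "n ^ 2"] by simp
    finally have powers: "p powi ((2 * m - n) ^ 2) * p powi ((m + 2 * n) ^ 2) =
      (p ^ 5) powi (m ^ 2) * (p ^ 5) powi (n ^ 2)" .
    have "G (2 * m - n, m + 2 * n) = (\<epsilon> (2 * m - n) * \<epsilon> (m + 2 * n)) *
            (p powi ((2 * m - n) ^ 2) * p powi ((m + 2 * n) ^ 2))"
      by (simp add: G_def)
    also have "\<dots> = (\<epsilon> m * \<epsilon> n) * ((p ^ 5) powi (m ^ 2) * (p ^ 5) powi (n ^ 2))"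
      by (simp only: lattice powers)
    finally show "G (case x of (m, n) \<Rightarrow> (2 * m - n, m + 2 * n)) =
      (case x of (m, n) \<Rightarrow> (\<epsilon> m * (p ^ 5) powi (m ^ 2)) * (\<epsilon> n * (p ^ 5) powi (n ^ 2)))"
      by (simp add: x)
  next
    fix y :: "int \<times> int" assume "y \<in> L"
    then obtain u v where y: "y = (u, v)" and "5 dvd u - 2 * v" by (auto simp: L)
    then obtain k where u: "u = 2 * v + 5 * k" by (auto simp: dvd_def algebra_simps)
    show "(case case y of (u, v) \<Rightarrow> ((2 * u + v) div 5, (2 * v - u) div 5) of
            (m, n) \<Rightarrow> (2 * m - n, m + 2 * n)) = y"
    proof -
      have "2 * u + v = 5 * (v + 2 * k)" "2 * v - u = 5 * (- k)" by (simp_all add: u)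
      hence "(2 * u + v) div 5 = v + 2 * k" "(2 * v - u) div 5 = - k"
        by (simp_all only: nonzero_mult_div_cancel_left zero_neq_numeral not_False_eq_True)
      thus ?thesis by (simp add: y u)
    qed
  qed auto
  finally have "(G has_sum (theta (p ^ 5) * theta (p ^ 5))) L" .
  from has_sum_unique[OF this 1] show ?thesis by (simp add: power2_eq_square)
qed

text \<open>If n is congruent to r mod 5, so are the squares, hence \<open>z powi (n ^ 2)\<close> is
  constant on the class.\<close>

lemma part_rotate:
  assumes "z ^ 5 = 1" "r \<in> {0..<5}"
  shows "part r (z * p) = z ^ nat (r ^ 2) * part r p"
proof -
  have z: "z \<noteq> 0" using assms(1) by auto
  have "\<epsilon> n * (z * p) powi (n ^ 2) = z ^ nat (r ^ 2) * (\<epsilon> n * p powi (n ^ 2))" if "n mod 5 = r" for n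
  proof -
    have n: "n = 5 * (n div 5) + r" using that by auto
    have "n ^ 2 = 5 * (5 * (n div 5) ^ 2 + 2 * (n div 5) * r) + r ^ 2"
      by (subst n) (simp add: power2_eq_square algebra_simps)
    hence "z powi (n ^ 2) = (z powi 5) powi (5 * (n div 5) ^ 2 + 2 * (n div 5) * r) * z powi (r ^ 2)"
      using z by (simp only: power_int_mult power_int_add simp_thms)
    also have "z powi 5 = 1" using assms(1) by simp
    also have "z powi (r ^ 2) = z ^ nat (r ^ 2)" by (simp add: power_int_def)
    finally show ?thesis by (simp add: power_int_mult_distrib)
  qed
  hence "part r (z * p) = (\<Sum>\<^sub>\<infinity>n | n mod 5 = r. z ^ nat (r ^ 2) * (\<epsilon> n * p powi (n ^ 2)))"
    unfolding part_def by (intro infsum_cong) auto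
  thus ?thesis by (simp only: part_def infsum_cmult_right')
qed

end

section \<open>Products over the fifth roots of unity\<close>

lemma fifth_root_sum:
  fixes z :: complex
  assumes "z ^ 5 = 1" "z \<noteq> 1"
  shows "1 + z + z ^ 2 + z ^ 3 + z ^ 4 = 0"
proof -
  have "(z - 1) * (1 + z + z ^ 2 + z ^ 3 + z ^ 4) = z ^ 5 - 1"
    by (simp add: algebra_simps power_numeral_reduce)
  thus ?thesis using assms by simp
qed

lemma fifth_root_power:
  fixes z :: complex
  assumes "z ^ 5 = 1" "z \<noteq> 1" "i \<in> {1, 2, 3, 4}"
  shows "(z ^ i) ^ 5 = 1" "z ^ i \<noteq> 1"
proof -
  have "(z ^ i) ^ 5 = (z ^ 5) ^ i" by (simp only: power_mult[symmetric] mult.commute)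
  thus "(z ^ i) ^ 5 = 1" using assms(1) by simp
  \<comment> \<open>Mod 5, the exponents 2 and 3 are inverse to each other and 4 is its own inverse,
    so \<open>z\<close> is a power of \<open>z ^ i\<close>.\<close>
  have "(z ^ 2) ^ 3 = z ^ 5 * z" "(z ^ 3) ^ 2 = z ^ 5 * z" "(z ^ 4) ^ 4 = (z ^ 5) ^ 3 * z"
    by (simp_all add: power_numeral_reduce)
  hence inverse: "(z ^ 2) ^ 3 = z" "(z ^ 3) ^ 2 = z" "(z ^ 4) ^ 4 = z"
    unfolding assms(1) by simp_all
  show "z ^ i \<noteq> 1"
  proof
    assume "z ^ i = 1"
    hence "z ^ 1 = 1 \<or> z ^ 2 = 1 \<or> z ^ 3 = 1 \<or> z ^ 4 = 1" using assms(3) by auto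
    hence "z = 1"
    proof (elim disjE)
      assume "z ^ 2 = 1" from inverse(1)[unfolded this] show ?thesis by simp
    next
      assume "z ^ 3 = 1" from inverse(2)[unfolded this] show ?thesis by simp
    next
      assume "z ^ 4 = 1" from inverse(3)[unfolded this] show ?thesis by simp
    qed simp
    with assms(2) show False ..
  qed
qed

text \<open>The factors for j and 5 - j are exchanged by z -> 1/z, so their product involves z only
  through the Gaussian periods s and t. The two products so obtained are conjugate, and s + t = s t
  = -1 removes the periods.\<close>

lemma fifth_root_prod:
  fixes z :: complex
  assumes "z ^ 5 = 1" "z \<noteq> 1"
  shows "(\<Prod>j<5. c + z ^ j * a + z ^ (4 * j) * b) =
           c ^ 5 + a ^ 5 + b ^ 5 - 5 * c ^ 3 * (a * b) + 5 * c * (a * b) ^ 2"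
proof -
  define s t where "s = z + z ^ 4" and "t = z ^ 2 + z ^ 3"
  define X Y W where "X = c ^ 2 + a ^ 2 + b ^ 2" and "Y = c * (a + b)" and "W = a * b"
  have pair: "(c + x * a + y * b) * (c + y * a + x * b) =
      X + (x + y) * Y + (x ^ 2 + y ^ 2) * W" if "x * y = 1" for x y
  proof -
    have "(c + x * a + y * b) * (c + y * a + x * b) =
        c ^ 2 + (x * y) * (a ^ 2 + b ^ 2) + (x + y) * Y + (x ^ 2 + y ^ 2) * W"
      by (simp add: Y_def W_def algebra_simps power2_eq_square)
    thus ?thesis using that by (simp add: X_def)
  qed
  have red: "z ^ 6 = z ^ 5 * z" "z ^ 8 = z ^ 5 * z ^ 3" "z ^ 12 = z ^ 5 * z ^ 5 * z ^ 2"
      "z ^ 16 = z ^ 5 * z ^ 5 * z ^ 5 * z" "z * z ^ 4 = z ^ 5" "z ^ 2 * z ^ 3 = z ^ 5"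
      "(z ^ 4) ^ 2 = z ^ 5 * z ^ 3" "(z ^ 3) ^ 2 = z ^ 5 * z" "(z ^ 2) ^ 2 = z ^ 4"
    by (simp_all add: power_numeral_reduce)
  have 1: "(c + z * a + z ^ 4 * b) * (c + z ^ 4 * a + z * b) = X + s * Y + t * W"
    using pair[of z "z ^ 4"] assms(1) by (simp add: red s_def t_def)
  have 2: "(c + z ^ 2 * a + z ^ 3 * b) * (c + z ^ 3 * a + z ^ 2 * b) = X + t * Y + s * W"
    using pair[of "z ^ 2" "z ^ 3"] assms(1) by (simp add: red s_def t_def add.commute)
  have "s + t = - 1"
    using fifth_root_sum[OF assms] unfolding s_def t_def by (simp add: eq_neg_iff_add_eq_0 add_ac)
  moreover have "s * t = z ^ 3 + z ^ 5 * z + z ^ 4 + z ^ 5 * z ^ 2"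
    by (simp add: s_def t_def algebra_simps power_numeral_reduce)
  hence "s * t = s + t" using assms(1) by (simp add: s_def t_def)
  ultimately have st: "t = - 1 - s" "s * t = - 1" by (simp_all add: algebra_simps)
  have "(\<Prod>j<5. c + z ^ j * a + z ^ (4 * j) * b) =
      (c + a + b) * ((c + z * a + z ^ 4 * b) * (c + z ^ 4 * a + z * b)) *
      ((c + z ^ 2 * a + z ^ 3 * b) * (c + z ^ 3 * a + z ^ 2 * b))"
    using assms(1) by (simp add: eval_nat_numeral(2-) lessThan_Suc red)
  also have "\<dots> = (c + a + b) * ((X + s * Y + t * W) * (X + t * Y + s * W))"
    unfolding 1 2 by (simp only: mult.assoc)
  also have "(X + s * Y + t * W) * (X + t * Y + s * W) =
      X ^ 2 + (s + t) * X * (Y + W) + (s * t) * (Y ^ 2 + W ^ 2) + ((s + t) ^ 2 - 2 * (s * t)) * Y * W"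
    by (simp add: algebra_simps power2_eq_square)
  also have "\<dots> = X ^ 2 - X * (Y + W) - (Y ^ 2 + W ^ 2) + 3 * Y * W"
    using st by simp
  also have "(c + a + b) * \<dots> =
      c ^ 5 + a ^ 5 + b ^ 5 - 5 * c ^ 3 * (a * b) + 5 * c * (a * b) ^ 2"
    unfolding X_def Y_def W_def by (simp add: algebra_simps power_numeral_reduce)
  finally show ?thesis .
qed

lemma fifth_root_prod_linear:
  fixes z :: complex
  assumes "z ^ 5 = 1" "z \<noteq> 1"
  shows "(\<Prod>j<5. 1 - z ^ j * x) = 1 - x ^ 5"
  using fifth_root_prod[OF assms, of 1 "- x" 0] by (simp add: power_numeral_reduce)

section \<open>Euler products at the rotated nomes\<close>

lemma euler_limit: "norm q < 1 \<Longrightarrow> qfac q \<longlonglongrightarrow> euler q"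
  using qpoch_limit[of q q] by (simp add: qfac_def[abs_def] euler_def)

lemma qfac_add: "qfac q (n + k) = qfac q n * (\<Prod>i<k. 1 - q ^ (n + Suc i))"
  by (induction k) (simp_all add: qfac_Suc mult.assoc)

text \<open>Over the five rotations, the factor 1 - q^n yields 1 - q^(5n) if 5 does not divide n,
  and (1 - q^n)^5 otherwise. The rotated product is therefore E(q^5)^5 times E(q^5) /
  E(q^25).\<close>

lemma euler_root_prod:
  assumes q: "norm q < 1" and z: "z ^ 5 = 1" "z \<noteq> 1"
  shows "(\<Prod>j<5. euler (z ^ j * q)) * euler (q ^ 25) = euler (q ^ 5) ^ 6"
proof -
  have split5: "(\<Prod>i<5. f i) = (\<Prod>i<4. f i) * f 4" for f :: "nat \<Rightarrow> complex"
    using prod.lessThan_Suc[of f 4] by simp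
  \<comment> \<open>The partial products grow in blocks of five exponents: four not divisible by 5
    and, at i = 4, the multiple \<open>5 * Suc M\<close>.\<close>
  have fin: "(\<Prod>j<5. qfac (z ^ j * q) (M * 5)) * qfac (q ^ 25) M = qfac (q ^ 5) M ^ 5 * qfac (q ^ 5) (M * 5)" for M
  proof (induction M)
    case (Suc M)
    have step: "qfac x (Suc M * 5) = qfac x (M * 5) * (\<Prod>i<5. 1 - x ^ (M * 5 + Suc i))" for x
      using qfac_add[of x "M * 5" 5] by (simp only: mult_Suc add.commute)
    have "(\<Prod>j<5. \<Prod>i<5. 1 - (z ^ j * q) ^ (M * 5 + Suc i)) =
            (\<Prod>i<5. \<Prod>j<5. 1 - (z ^ j * q) ^ (M * 5 + Suc i))" by (rule prod.swap)
    also have "\<dots> = (\<Prod>i<4. 1 - (q ^ 5) ^ (M * 5 + Suc i)) * (1 - (q ^ 5) ^ Suc M) ^ 5"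
    proof -
      have zp: "(z ^ j * q) ^ (M * 5 + k) = (z ^ k) ^ j * q ^ (M * 5 + k)" for j k
      proof -
        have "j * (M * 5 + k) = 5 * (j * M) + k * j" by (simp add: algebra_simps)
        hence "(z ^ j) ^ (M * 5 + k) = z ^ (5 * (j * M) + k * j)"
          by (simp only: power_mult[symmetric])
        also have "\<dots> = (z ^ 5) ^ (j * M) * (z ^ k) ^ j"
          by (simp only: power_mult power_add)
        finally have "(z ^ j) ^ (M * 5 + k) = (z ^ 5) ^ (j * M) * (z ^ k) ^ j" .
        thus ?thesis unfolding z(1) by (simp only: power_mult_distrib power_one mult_1_left)
      qed
      have lo: "(\<Prod>j<5. 1 - (z ^ j * q) ^ (M * 5 + Suc i)) = 1 - (q ^ 5) ^ (M * 5 + Suc i)" if "i < 4" for i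
      proof -
        have "Suc i \<in> {1, 2, 3, 4}" using that by auto
        from fifth_root_prod_linear[OF fifth_root_power[OF z this]]
        have "(\<Prod>j<5. 1 - (z ^ j * q) ^ (M * 5 + Suc i)) = 1 - (q ^ (M * 5 + Suc i)) ^ 5"
          unfolding zp .
        thus ?thesis by (simp only: power_mult[symmetric] mult.commute)
      qed
      have hi: "(\<Prod>j<5. 1 - (z ^ j * q) ^ (M * 5 + Suc 4)) = (1 - (q ^ 5) ^ Suc M) ^ 5"
      proof -
        have "M * 5 + Suc 4 = 5 * Suc M" by simp
        hence "q ^ (M * 5 + Suc 4) = (q ^ 5) ^ Suc M" by (simp only: power_mult)
        moreover have "z ^ Suc 4 = 1" using z by simp
        ultimately show ?thesis unfolding zp by (simp only: power_one) simp
      qed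
      show ?thesis
        by (rule trans[OF split5], rule arg_cong2[of _ _ _ _ "(*)"], rule prod.cong[OF refl lo])
           (simp_all only: lessThan_iff hi)
    qed
    finally have "(\<Prod>j<5. qfac (z ^ j * q) (Suc M * 5)) * qfac (q ^ 25) (Suc M) =
        ((\<Prod>j<5. qfac (z ^ j * q) (M * 5)) * qfac (q ^ 25) M) *
        ((\<Prod>i<4. 1 - (q ^ 5) ^ (M * 5 + Suc i)) * (1 - (q ^ 5) ^ Suc M) ^ 5 * (1 - (q ^ 25) ^ Suc M))"
      by (simp only: step qfac_Suc prod.distrib mult_ac)
    moreover have "qfac (q ^ 5) (Suc M * 5) = qfac (q ^ 5) (M * 5) *
        ((\<Prod>i<4. 1 - (q ^ 5) ^ (M * 5 + Suc i)) * (1 - (q ^ 25) ^ Suc M))"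
    proof -
      have "5 * (M * 5 + Suc 4) = 25 * Suc M" by simp
      hence "(q ^ 5) ^ (M * 5 + Suc 4) = (q ^ 25) ^ Suc M" by (simp only: power_mult[symmetric])
      thus ?thesis unfolding step split5 by (simp only:)
    qed
    ultimately show ?case unfolding Suc.IH
      by (simp only: qfac_Suc power_mult_distrib mult_ac)
  qed simp
  have z1: "norm z = 1"
    using power_eq_1_iff[OF z(1)] by simp
  have lt: "norm (z ^ j * q) < 1" for j using q z1 by (simp add: norm_mult norm_power)
  have lt': "norm (q ^ 5) < 1" "norm (q ^ 25) < 1"
    using q by (simp_all add: norm_power power_less_one_iff)
  have sub: "(\<lambda>M. qfac x (M * 5)) \<longlonglongrightarrow> euler x" if "norm x < 1" for x
    using LIMSEQ_subseq_LIMSEQ[OF euler_limit[OF that], of "\<lambda>M. M * 5"]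
    by (simp add: strict_mono_def o_def)
  have 1: "(\<lambda>M. (\<Prod>j<5. qfac (z ^ j * q) (M * 5)) * qfac (q ^ 25) M) \<longlonglongrightarrow>
          (\<Prod>j<5. euler (z ^ j * q)) * euler (q ^ 25)"
    by (intro tendsto_mult tendsto_prod sub lt euler_limit[OF lt'(2)])
  have "(\<lambda>M. qfac (q ^ 5) M ^ 5 * qfac (q ^ 5) (M * 5)) \<longlonglongrightarrow> euler (q ^ 5) ^ 5 * euler (q ^ 5)"
    by (intro tendsto_mult tendsto_power sub euler_limit lt'(1))
  with 1 have "(\<Prod>j<5. euler (z ^ j * q)) * euler (q ^ 25) = euler (q ^ 5) ^ 5 * euler (q ^ 5)"
    unfolding fin by (rule LIMSEQ_unique)
  thus ?thesis by (simp add: power_numeral_reduce)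
qed

section \<open>Two theta identities of level 10\<close>

text \<open>The theta function \<theta> of the introduction, given by its product because the
  product over rotations is read off from it; \<open>alternating_theta\<close> supplies the
  series.\<close>

definition theta4 :: "complex \<Rightarrow> complex" where
  "theta4 q = euler q ^ 2 / euler (q ^ 2)"

text \<open>Ramanujan's psi, the generating function of the triangular numbers T; it enters through
  the odd squares 8T + 1.\<close>

definition psi :: "complex \<Rightarrow> complex" where
  "psi q = euler (q ^ 2) ^ 2 / euler q"

lemma norm_power_less_one: "norm (q :: complex) < 1 \<Longrightarrow> k > 0 \<Longrightarrow> norm (q ^ k) < 1"
  by (simp add: norm_power power_less_one_iff)

lemma qpoch_square_base:
  assumes "norm q < 1"
  shows "qpoch q (q ^ 2) = euler q / euler (q ^ 2)"
proof -
  have "euler q = qpoch q (q ^ 2) * qpoch (q * q) (q ^ 2)"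
    using qpoch_split[OF assms, of 2 q] by (simp add: euler_def eval_nat_numeral lessThan_Suc mult.commute)
  moreover have "qpoch (q * q) (q ^ 2) = euler (q ^ 2)" by (simp add: euler_def power2_eq_square)
  ultimately show ?thesis
    using euler_nonzero[OF norm_power_less_one[OF assms, of 2]] by simp
qed

lemma qpoch_minus:
  assumes "norm q < 1"
  shows "qpoch (- q) q = euler (q ^ 2) / euler q"
  using qpoch_mult_neg[OF assms, of q] euler_nonzero[OF assms]
  by (simp add: euler_def field_simps)

section \<open>Product formulas for the two theta series and their parts\<close>

interpretation alternating: quintic_weight "\<lambda>n. if even n then 1 else - 1"
  by unfold_locales auto

interpretation odd: quintic_weight "\<lambda>n. if odd n then 1 else 0"
  by unfold_locales auto

lemma sign_powi: "(if even n then 1 else - 1) = (- 1 :: complex) powi n"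
  by (simp add: power_int_minus_left)

lemma alternating_theta:
  assumes "norm p < 1" "p \<noteq> 0"
  shows "alternating.theta p = theta4 p"
proof -
  have "((\<lambda>n. (if even n then 1 else - 1) * p powi (n ^ 2)) has_sum
          (euler (p ^ 2) * qpoch p (p ^ 2) * qpoch p (p ^ 2))) UNIV"
    using jacobi_triple_product_quadratic[OF assms, of "- 1" 1 0] by (simp add: sign_powi)
  from has_sum_unique[OF alternating.has_sum_theta[OF assms] this]
  have "alternating.theta p = euler (p ^ 2) * qpoch p (p ^ 2) * qpoch p (p ^ 2)" .
  moreover have "F * (E / F) * (E / F) = E ^ 2 / F" if "F \<noteq> 0" for E F :: complex
    using that by (simp add: field_simps power2_eq_square)
  ultimately show ?thesis
    using euler_nonzero[OF norm_power_less_one[OF assms(1), of 2]]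
    by (simp only: qpoch_square_base[OF assms(1)] theta4_def zero_less_numeral simp_thms)
qed

text \<open>With n = 5k + 1 the exponent is 25k^2 + 10k + 1 and the sign is -(-1)^k, so the triple
  product applies.\<close>

lemma alternating_part_1:
  assumes "norm p < 1" "p \<noteq> 0"
  shows "alternating.part 1 p = - p * (euler (p ^ 50) * qpoch (p ^ 35) (p ^ 50) * qpoch (p ^ 15) (p ^ 50))"
proof -
  have eq: "(if even (5 * n + 1) then 1 else - 1) * p powi ((5 * n + 1) ^ 2) =
          - p * ((- 1) powi n * p powi (25 * n ^ 2 + 10 * n))" for n :: int
  proof -
    have "(5 * n + 1) ^ 2 = (25 * n ^ 2 + 10 * n) + 1" by (simp add: power2_eq_square algebra_simps)
    hence "p powi ((5 * n + 1) ^ 2) = p powi (25 * n ^ 2 + 10 * n) * p"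
      using assms(2) by (simp only: power_int_add_1 simp_thms)
    thus ?thesis unfolding sign_powi[symmetric] by simp
  qed
  have "((\<lambda>n. - p * ((- 1) powi n * p powi (25 * n ^ 2 + 10 * n))) has_sum
          (- p * (euler (p ^ 50) * qpoch (p ^ 35) (p ^ 50) * qpoch (p ^ 15) (p ^ 50)))) UNIV"
    using jacobi_triple_product_quadratic[OF assms, of "- 1" 25 10]
    by (intro has_sum_cmult_right) simp
  from has_sum_unique[OF alternating.has_sum_part_shift[OF assms, of 1, unfolded eq] this]
  show ?thesis by simp
qed

lemma alternating_part_2:
  assumes "norm p < 1" "p \<noteq> 0"
  shows "alternating.part 2 p = p ^ 4 * (euler (p ^ 50) * qpoch (p ^ 45) (p ^ 50) * qpoch (p ^ 5) (p ^ 50))"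
proof -
  have eq: "(if even (5 * n + 2) then 1 else - 1) * p powi ((5 * n + 2) ^ 2) =
          p ^ 4 * ((- 1) powi n * p powi (25 * n ^ 2 + 20 * n))" for n :: int
  proof -
    have "(5 * n + 2) ^ 2 = (25 * n ^ 2 + 20 * n) + 4" by (simp add: power2_eq_square algebra_simps)
    hence "p powi ((5 * n + 2) ^ 2) = p powi (25 * n ^ 2 + 20 * n) * p powi 4"
      using assms(2) by (simp only: power_int_add simp_thms)
    thus ?thesis unfolding sign_powi[symmetric] by simp
  qed
  have "((\<lambda>n. p ^ 4 * ((- 1) powi n * p powi (25 * n ^ 2 + 20 * n))) has_sum
          (p ^ 4 * (euler (p ^ 50) * qpoch (p ^ 45) (p ^ 50) * qpoch (p ^ 5) (p ^ 50)))) UNIV"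
    using jacobi_triple_product_quadratic[OF assms, of "- 1" 25 20]
    by (intro has_sum_cmult_right) simp
  from has_sum_unique[OF alternating.has_sum_part_shift[OF assms, of 2, unfolded eq] this]
  show ?thesis by simp
qed

lemma odd_theta:
  assumes "norm p < 1" "p \<noteq> 0"
  shows "odd.theta p = 2 * p * psi (p ^ 8)"
proof -
  have p8: "norm (p ^ 8) < 1" by (rule norm_power_less_one) (use assms in auto)
  note odd.has_sum_theta[OF assms]
  also have "((\<lambda>n. (if odd n then 1 else 0) * p powi (n ^ 2)) has_sum odd.theta p) UNIV \<longleftrightarrow>
      ((\<lambda>n. (if odd n then 1 else 0) * p powi (n ^ 2)) has_sum odd.theta p) {n. odd n}"
    by (rule has_sum_cong_neutral) auto
  also have "\<dots> \<longleftrightarrow> ((\<lambda>k. p powi ((2 * k + 1) ^ 2)) has_sum odd.theta p) UNIV"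
    by (rule has_sum_reindex_bij_witness[of _ "\<lambda>k. 2 * k + 1" "\<lambda>n. n div 2"]) auto
  also have "(\<lambda>k. p powi ((2 * k + 1) ^ 2)) = (\<lambda>k. p * (1 powi k * p powi (4 * k ^ 2 + 4 * k)))"
  proof
    fix k :: int
    have "(2 * k + 1) ^ 2 = (4 * k ^ 2 + 4 * k) + 1" by (simp add: power2_eq_square algebra_simps)
    hence "p powi ((2 * k + 1) ^ 2) = p powi (4 * k ^ 2 + 4 * k) * p"
      using assms(2) by (simp only: power_int_add_1 simp_thms)
    thus "p powi ((2 * k + 1) ^ 2) = p * (1 powi k * p powi (4 * k ^ 2 + 4 * k))" by simp
  qed
  finally have 1: "((\<lambda>k. p * (1 powi k * p powi (4 * k ^ 2 + 4 * k))) has_sum odd.theta p) UNIV" .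
  have "((\<lambda>k. p * (1 powi k * p powi (4 * k ^ 2 + 4 * k))) has_sum
          (p * (euler (p ^ 8) * qpoch (- (p ^ 8)) (p ^ 8) * qpoch (- 1) (p ^ 8)))) UNIV"
    using jacobi_triple_product_quadratic[OF assms, of 1 4 4] by (intro has_sum_cmult_right) simp
  from has_sum_unique[OF 1 this]
  have "odd.theta p = p * (euler (p ^ 8) * qpoch (- (p ^ 8)) (p ^ 8) * qpoch (- 1) (p ^ 8))" .
  \<comment> \<open>The lower exponent in the triple product is 4 - 4 = 0; the resulting first
    factor 1 + 1 is the 2 in the claim.\<close>
  moreover have "qpoch (- 1) (p ^ 8) = 2 * qpoch (- (p ^ 8)) (p ^ 8)"
    using qpoch_head[OF p8, of "- 1"] by simp
  moreover have "p * (E * (F / E) * (2 * (F / E))) = 2 * p * (F ^ 2 / E)" if "E \<noteq> 0" for E F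
    using that by (simp add: field_simps power2_eq_square)
  ultimately show ?thesis
    using euler_nonzero[OF p8] by (simp only: qpoch_minus[OF p8] psi_def simp_thms)
qed

text \<open>The odd n in the class r mod 5 form a single class mod 10, that of s. Leaving the
  representative s free allows both exponents \<open>100 + 20 * s\<close> and
  \<open>100 - 20 * s\<close> to be made positive.\<close>

lemma odd_part:
  assumes "norm p < 1" "p \<noteq> 0" "odd s" "s mod 5 = r"
  shows "odd.part r p = p powi (s ^ 2) *
    (euler (p ^ 200) * qpoch (- (p powi (100 + 20 * s))) (p ^ 200) * qpoch (- (p powi (100 - 20 * s))) (p ^ 200))"
proof -
  have residue: "n mod 5 = r \<and> odd n \<longleftrightarrow> n mod 10 = s mod 10" for n :: int
  proof -
    have "10 dvd d \<longleftrightarrow> 5 dvd d \<and> even d" for d :: int by presburger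
    hence "10 dvd n - s \<longleftrightarrow> 5 dvd n - s \<and> even (n - s)" .
    thus ?thesis using assms(3,4) by (auto simp: odd_iff_mod_2_eq_one mod_eq_dvd_iff[symmetric])
  qed
  note odd.has_sum_part[OF assms(1,2)]
  also have "((\<lambda>n. (if odd n then 1 else 0) * p powi (n ^ 2)) has_sum odd.part r p) {n. n mod 5 = r} \<longleftrightarrow>
      ((\<lambda>n. (if odd n then 1 else 0) * p powi (n ^ 2)) has_sum odd.part r p) {n. n mod 5 = r \<and> odd n}"
    by (rule has_sum_cong_neutral) auto
  also have "\<dots> \<longleftrightarrow> ((\<lambda>k. p powi ((10 * k + s) ^ 2)) has_sum odd.part r p) UNIV"
    by (rule has_sum_reindex_bij_witness[of _ "\<lambda>k. 10 * k + s" "\<lambda>n. (n - s) div 10"])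
       (use assms(3) residue in \<open>auto simp: mod_eq_dvd_iff\<close>)
  also have "(\<lambda>k. p powi ((10 * k + s) ^ 2)) =
               (\<lambda>k. p powi (s ^ 2) * (1 powi k * p powi (100 * k ^ 2 + (20 * s) * k)))"
  proof
    fix k :: int
    have "(10 * k + s) ^ 2 = s ^ 2 + (100 * k ^ 2 + (20 * s) * k)"
      by (simp add: power2_eq_square algebra_simps)
    hence "p powi ((10 * k + s) ^ 2) = p powi (s ^ 2) * p powi (100 * k ^ 2 + (20 * s) * k)"
      using assms(2) by (simp only: power_int_add simp_thms)
    thus "p powi ((10 * k + s) ^ 2) = p powi (s ^ 2) * (1 powi k * p powi (100 * k ^ 2 + (20 * s) * k))"
      by simp
  qed
  finally have 1: "((\<lambda>k. p powi (s ^ 2) * (1 powi k * p powi (100 * k ^ 2 + (20 * s) * k))) has_sum odd.part r p) UNIV" .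
  have "((\<lambda>k. p powi (s ^ 2) * (1 powi k * p powi (100 * k ^ 2 + (20 * s) * k))) has_sum
      (p powi (s ^ 2) * (euler (p ^ 200) * qpoch (- (p powi (100 + 20 * s))) (p ^ 200) *
       qpoch (- (p powi (100 - 20 * s))) (p ^ 200)))) UNIV"
    using jacobi_triple_product_quadratic[OF assms(1,2), of 1 100 "20 * s"] by (intro has_sum_cmult_right) simp
  from has_sum_unique[OF 1 this] show ?thesis .
qed

section \<open>The two identities, from the dissection at a root of the nome\<close>

lemma exists_root:
  fixes q :: complex
  assumes "norm q < 1" "q \<noteq> 0" "k > 0"
  obtains p where "q = p ^ k" "norm p < 1" "p \<noteq> 0"
proof -
  define p where "p = exp (Ln q / of_nat k)"
  have "p ^ k = exp (of_nat k * (Ln q / of_nat k))"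
    unfolding p_def by (rule exp_of_nat_mult[symmetric])
  also have "of_nat k * (Ln q / of_nat k) = Ln q" using assms(3) by simp
  also have "exp (Ln q) = q" by (rule exp_Ln[OF assms(2)])
  finally have p: "q = p ^ k" ..
  have "norm p < 1"
  proof (rule ccontr)
    assume "\<not> norm p < 1"
    hence "norm p ^ k \<ge> 1" by (simp add: one_le_power)
    thus False using p assms(1) by (simp add: norm_power)
  qed
  with p show ?thesis using that[of p] by (simp add: p_def)
qed

lemma times_quotient_eq:
  fixes x y u v w :: complex
  assumes "y \<noteq> 0" "v \<noteq> 0" "x * (y / v) = u / w"
  shows "x = u * v / (w * y)"
proof -
  have "x = x * (y / v) * (v / y)" using assms(1,2) by simp
  also have "\<dots> = u * v / (w * y)" unfolding assms(3) by simp
  finally show ?thesis .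
qed

text \<open>Apply \<open>theta_square\<close> at a fifth root p of q. The triple products of the two
  parts run over the residues 1, 3, 7, 9 mod 10; together with 5 these are all odd residues, which
  evaluates their product.\<close>

lemma theta4_identity:
  assumes q: "norm q < 1" "q \<noteq> 0"
  shows "theta4 q ^ 2 = theta4 (q ^ 5) ^ 2 - 4 * q * euler (q ^ 10) ^ 3 * euler q / (euler (q ^ 2) * euler (q ^ 5))"
proof -
  obtain p where p: "q = p ^ 5" "norm p < 1" "p \<noteq> 0"
    using exists_root[OF q, of 5] by auto
  have pq: "p ^ 50 = q ^ 10" "p ^ 35 = q ^ 7" "p ^ 15 = q ^ 3" "p ^ 45 = q ^ 9" "p ^ 25 = q ^ 5"
    unfolding p(1) by (simp_all flip: power_mult)
  have p25: "norm (p ^ 25) < 1" "p ^ 25 \<noteq> 0" using norm_power_less_one[OF p(2)] p(3) by auto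
  define E R where "E = euler (q ^ 10)" and "R = (\<lambda>j. qpoch (q ^ j) (q ^ 10))"
  have q2: "norm (q ^ 2) < 1" and q5: "norm (q ^ 5) < 1" and q10: "norm (q ^ 10) < 1"
    using norm_power_less_one[OF q(1)] by auto
  have nz: "euler q \<noteq> 0" "euler (q ^ 2) \<noteq> 0" "euler (q ^ 5) \<noteq> 0" "E \<noteq> 0"
    unfolding E_def by (intro euler_nonzero q q2 q5 q10)+
  have "qpoch q (q ^ 2) = (\<Prod>i<5. qpoch (q * (q ^ 2) ^ i) ((q ^ 2) ^ 5))"
    by (rule qpoch_split[OF q2]) simp
  also have "\<dots> = (\<Prod>i<5. R (2 * i + 1))" by (simp add: R_def flip: power_mult)
  also have "\<dots> = R 1 * R 3 * R 5 * R 7 * R 9" by (simp add: eval_nat_numeral lessThan_Suc mult_ac)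
  finally have "R 1 * R 3 * R 5 * R 7 * R 9 = euler q / euler (q ^ 2)"
    by (simp add: qpoch_square_base[OF q(1)])
  moreover have R5: "R 5 = euler (q ^ 5) / E"
    using qpoch_square_base[OF q5] by (simp add: R_def E_def flip: power_mult)
  ultimately have "(R 1 * R 3 * R 7 * R 9) * (euler (q ^ 5) / E) = euler q / euler (q ^ 2)"
    by (simp only: mult_ac)
  hence R: "R 1 * R 3 * R 7 * R 9 = euler q * E / (euler (q ^ 2) * euler (q ^ 5))"
    by (rule times_quotient_eq[OF nz(3,4)])
  have 1: "alternating.part 1 p = - p * (E * R 7 * R 3)"
    unfolding alternating_part_1[OF p(2,3)] pq E_def R_def ..
  have 2: "alternating.part 2 p = p ^ 4 * (E * R 9 * R 1)"
    unfolding alternating_part_2[OF p(2,3)] pq p(1)[symmetric] E_def R_def by simp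
  \<comment> \<open>The prefactors -p and p^4 combine to -q, so the root disappears.\<close>
  have "alternating.part 1 p * alternating.part 2 p = - (p ^ 5) * E ^ 2 * (R 1 * R 3 * R 7 * R 9)"
    unfolding 1 2 by (simp add: algebra_simps power_numeral_reduce)
  hence parts: "alternating.part 1 p * alternating.part 2 p =
      - q * E ^ 2 * (euler q * E / (euler (q ^ 2) * euler (q ^ 5)))"
    unfolding R p(1)[symmetric] .
  have "alternating.part 0 p = theta4 (q ^ 5)"
    using alternating.part_0[OF p(2,3)] alternating_theta[OF p25] by (simp add: pq)
  hence "theta4 q ^ 2 = theta4 (q ^ 5) ^ 2 + 4 * (alternating.part 1 p * alternating.part 2 p)"
    using alternating.theta_square[OF p(2,3)] unfolding p(1)[symmetric] alternating_theta[OF q]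
    by (simp only: mult.assoc)
  moreover have "4 * (- q * E ^ 2 * (x * E / y)) = - (4 * q * E ^ 3 * x / y)" for x y
    by (simp add: power2_eq_square power3_eq_cube mult_ac)
  ultimately show ?thesis unfolding parts E_def by simp
qed

text \<open>The exponents \<open>n\<^sup>2\<close> for odd \<open>n\<close> are \<open>1 (mod 8)\<close>, and the dissection only yields the identity at a
  fifth power of the nome, whence the 40th root.\<close>

lemma psi_identity:
  assumes q: "norm q < 1" "q \<noteq> 0"
  shows "psi q ^ 2 = q * psi (q ^ 5) ^ 2 + euler (q ^ 2) * euler (q ^ 5) ^ 3 / (euler q * euler (q ^ 10))"
proof -
  obtain p where p: "q = p ^ 40" "norm p < 1" "p \<noteq> 0"
    using exists_root[OF q, of 40] by auto
  have pq: "p ^ 200 = q ^ 5" "p ^ 120 = q ^ 3" "p ^ 80 = q ^ 2" "p ^ 160 = q ^ 4"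
      "(p ^ 5) ^ 8 = q" "(p ^ 25) ^ 8 = q ^ 5"
    unfolding p(1) by (simp_all flip: power_mult)
  have p5: "norm (p ^ 5) < 1" "p ^ 5 \<noteq> 0" and p25: "norm (p ^ 25) < 1" "p ^ 25 \<noteq> 0"
    using norm_power_less_one[OF p(2)] p(3) by auto
  define E R where "E = euler (q ^ 5)" and "R = (\<lambda>j. qpoch (- (q ^ j)) (q ^ 5))"
  have q2: "norm (q ^ 2) < 1" and q5: "norm (q ^ 5) < 1" and q10: "norm (q ^ 10) < 1"
    using norm_power_less_one[OF q(1)] by auto
  have nz: "euler q \<noteq> 0" "euler (q ^ 2) \<noteq> 0" "E \<noteq> 0" "euler (q ^ 10) \<noteq> 0"
    unfolding E_def by (intro euler_nonzero q q2 q5 q10)+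
  \<comment> \<open>Sort (-q; q) by exponent mod 5. The parts use the residues 1 to 4, and
    \<open>R 5\<close> is divided out.\<close>
  have "qpoch (- q) q = (\<Prod>i<5. qpoch (- q * q ^ i) (q ^ 5))"
    by (rule qpoch_split[OF q(1)]) simp
  also have "\<dots> = (\<Prod>i<5. R (i + 1))" by (simp add: R_def)
  also have "\<dots> = R 1 * R 2 * R 3 * R 4 * R 5" by (simp add: eval_nat_numeral lessThan_Suc mult_ac)
  finally have "R 1 * R 2 * R 3 * R 4 * R 5 = euler (q ^ 2) / euler q"
    by (simp add: qpoch_minus[OF q(1)])
  moreover have R5: "R 5 = euler (q ^ 10) / E"
    using qpoch_minus[OF q5] by (simp add: R_def E_def flip: power_mult)
  ultimately have "(R 1 * R 2 * R 3 * R 4) * (euler (q ^ 10) / E) = euler (q ^ 2) / euler q"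
    by (simp only: mult_ac)
  hence R: "R 1 * R 2 * R 3 * R 4 = euler (q ^ 2) * E / (euler q * euler (q ^ 10))"
    by (rule times_quotient_eq[OF nz(4,3)])
  have 1: "odd.part 1 p = p * (E * R 3 * R 2)"
    using odd_part[OF p(2,3), of 1 1] by (simp add: pq E_def R_def)
  \<comment> \<open>-3 is the odd representative of 2 mod 5 for which both exponents, 40 and 160,
    are positive.\<close>
  have 2: "odd.part 2 p = p ^ 9 * (E * R 1 * R 4)"
    using odd_part[OF p(2,3), of "-3" 2] by (simp add: pq E_def R_def flip: p(1))
  have "odd.part 1 p * odd.part 2 p = p ^ 10 * (E ^ 2 * (R 1 * R 2 * R 3 * R 4))"
    unfolding 1 2 by (simp add: algebra_simps power_numeral_reduce)
  hence parts: "odd.part 1 p * odd.part 2 p = p ^ 10 * (E ^ 2 * (euler (q ^ 2) * E / (euler q * euler (q ^ 10))))"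
    unfolding R .
  have t5: "odd.theta (p ^ 5) = 2 * p ^ 5 * psi q"
    using odd_theta[OF p5] by (simp only: pq)
  have t0: "odd.part 0 p = 2 * p ^ 25 * psi (q ^ 5)"
    using odd.part_0[OF p(2,3)] odd_theta[OF p25] by (simp only: pq)
  have "(2 * p ^ 5 * psi q) ^ 2 = (2 * p ^ 25 * psi (q ^ 5)) ^ 2 + 4 * (odd.part 1 p * odd.part 2 p)"
    using odd.theta_square[OF p(2,3)] unfolding t5 t0 by (simp only: mult.assoc)
  \<comment> \<open>Every term is thus \<open>4 * p ^ 10\<close> times a function of q, and this
    factor cancels.\<close>
  moreover have "p ^ 50 = p ^ 10 * q" unfolding p(1) by (simp flip: power_add)
  ultimately have "4 * p ^ 10 * psi q ^ 2 = 4 * p ^ 10 * (q * psi (q ^ 5) ^ 2 +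
      E ^ 2 * (euler (q ^ 2) * E / (euler q * euler (q ^ 10))))"
    unfolding parts by (simp add: power_mult_distrib algebra_simps flip: power_mult)
  hence "psi q ^ 2 = q * psi (q ^ 5) ^ 2 + E ^ 2 * (euler (q ^ 2) * E / (euler q * euler (q ^ 10)))"
    using p(3) by simp
  thus ?thesis by (simp add: E_def power_numeral_reduce mult_ac)
qed

section \<open>The modular equation\<close>

lemma bpoly_sum:
  "(\<Sum>k=0..4. poly (bpoly k) y * x ^ k) =
     - (y ^ 5) + (1 + 5 * y + 5 * y ^ 2 + 5 * y ^ 3 + 5 * y ^ 4 - 16 * y ^ 5) * x
     + (- 4 - 15 * y + 10 * y ^ 2 + 35 * y ^ 3 + 60 * y ^ 4 - 96 * y ^ 5) * x ^ 2
     + (6 + 15 * y - 35 * y ^ 2 + 40 * y ^ 3 + 240 * y ^ 4 - 256 * y ^ 5) * x ^ 3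
     + (- 4 - 5 * y + 20 * y ^ 2 - 80 * y ^ 3 + 320 * y ^ 4 - 256 * y ^ 5) * x ^ 4"
proof -
  have "{0..4::nat} = {0, 1, 2, 3, 4}" by auto
  thus ?thesis by (simp add: bpoly_def algebra_simps power_numeral_reduce)
qed

text \<open>The assumption \<open>norm\<close> is symmetric in \<alpha> and \<beta>, whose sum a - c
  and product b^2 - c^2 are known. This leaves a homogeneous relation of degree six in a, b, c,
  which depends only on their ratios.\<close>

lemma modular_relation_from_theta_relation:
  fixes a b c \<alpha> \<beta> x y :: complex
  assumes nz: "a \<noteq> 0" "b \<noteq> 0"
    and a: "a = c + \<alpha> + \<beta>" and b: "b ^ 2 = c ^ 2 + \<alpha> * \<beta>"
    and norm: "(c ^ 5 + \<alpha> ^ 5 + \<beta> ^ 5 - 5 * c ^ 3 * (\<alpha> * \<beta>) + 5 * c * (\<alpha> * \<beta>) ^ 2) * c = b ^ 6"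
    and x: "4 * x + 1 = 5 * b ^ 2 / a ^ 2" and y: "4 * y + 1 = 5 * c ^ 2 / b ^ 2"
  shows "x ^ 5 + (\<Sum>k=0..4. poly (bpoly k) y * x ^ k) = 0"
proof -
  define A B C where "A = a ^ 2" and "B = b ^ 2" and "C = c ^ 2"
  define s where "s = B - C"
  define M N where "M = - 5 * A ^ 2 * C - 10 * A * C ^ 2 + 15 * s * A * C - B ^ 3"
    and "N = A ^ 2 + 10 * A * C + 5 * C ^ 2 - 5 * s * (A + 3 * C) + 5 * s ^ 2"
  \<comment> \<open>Only \<open>a\<^sup>2\<close> is determined by \<open>x\<close> and \<open>y\<close>, so the relation is split as \<open>M + a c N = 0\<close> into its
    parts \<open>M\<close> and \<open>N\<close> in the squares \<open>A\<close>, \<open>B\<close>, \<open>C\<close>, and \<open>a c\<close> is eliminated by squaring.\<close>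
  have s: "\<alpha> * \<beta> = s" using b by (simp add: s_def B_def C_def)
  \<comment> \<open>The fifth power sum in terms of the elementary symmetric functions.\<close>
  have "\<alpha> ^ 5 + \<beta> ^ 5 = (\<alpha> + \<beta>) ^ 5 - 5 * (\<alpha> + \<beta>) ^ 3 * (\<alpha> * \<beta>) + 5 * (\<alpha> + \<beta>) * (\<alpha> * \<beta>) ^ 2"
    by (simp add: algebra_simps power_numeral_reduce)
  also have "\<alpha> + \<beta> = a - c" using a by simp
  finally have pow: "\<alpha> ^ 5 + \<beta> ^ 5 = (a - c) ^ 5 - 5 * (a - c) ^ 3 * s + 5 * (a - c) * s ^ 2"
    unfolding s .
  have "B ^ 3 = b ^ 6" by (simp add: B_def)
  also have "\<dots> = (c ^ 5 + (\<alpha> ^ 5 + \<beta> ^ 5) - 5 * c ^ 3 * s + 5 * c * s ^ 2) * c"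
    using norm unfolding s by (simp add: add.assoc)
  also have "\<dots> = (c ^ 5 + ((a - c) ^ 5 - 5 * (a - c) ^ 3 * s + 5 * (a - c) * s ^ 2)
                  - 5 * c ^ 3 * s + 5 * c * s ^ 2) * c"
    unfolding pow ..
  also have "\<dots> = M + B ^ 3 + a * c * N"
    unfolding M_def N_def A_def C_def by (simp add: algebra_simps power_numeral_reduce)
  finally have "M = - (a * c * N)" by (simp add: eq_neg_iff_add_eq_0)
  hence MN: "M ^ 2 = A * C * N ^ 2"
    by (simp add: A_def C_def power_mult_distrib)
  \<comment> \<open>u = 5B/A and v = 5C/B are the ratios known from x and y, and k is the common
    scale; the 25 avoids fractions.\<close>
  define k u v where "k = A / 25" and "u = 4 * x + 1" and "v = 4 * y + 1"
  have A: "A = 25 * k" and B: "B = 5 * k * u" and C: "C = k * u * v"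
    using nz x y by (simp_all add: k_def u_def v_def A_def B_def C_def field_simps)
  have k: "k \<noteq> 0" "u \<noteq> 0" using nz A B by (auto simp: A_def B_def)
  define m n where "m = - 3125 * v - 250 * u * v ^ 2 + 375 * u * (5 - v) * v - 125 * u ^ 2"
    and "n = 625 + 250 * u * v + 5 * u ^ 2 * v ^ 2 - 5 * u * (5 - v) * (25 + 3 * u * v) + 5 * u ^ 2 * (5 - v) ^ 2"
  have "M = k ^ 3 * u * m" unfolding M_def s_def A B C m_def
    by (simp add: algebra_simps power_numeral_reduce)
  moreover have "N = k ^ 2 * n" unfolding N_def s_def A B C n_def
    by (simp add: algebra_simps power_numeral_reduce)
  moreover have "A * C = 25 * k ^ 2 * u * v" by (simp add: A C power2_eq_square)
  ultimately have "(k ^ 3 * u * m) ^ 2 = 25 * k ^ 2 * u * v * (k ^ 2 * n) ^ 2" using MN by simp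
  hence "k ^ 6 * u * (u * m ^ 2 - 25 * v * n ^ 2) = 0"
    by (simp add: algebra_simps power_numeral_reduce)
  hence "u * m ^ 2 - 25 * v * n ^ 2 = 0" using k by simp
  \<comment> \<open>16000000 = 125^2 * 4^5 is the coefficient of x^5, which comes from the term -125
    u^2 of \<open>m\<close> and from u = 4x + 1.\<close>
  moreover have "u * m ^ 2 - 25 * v * n ^ 2 =
      16000000 * (x ^ 5 + (\<Sum>k=0..4. poly (bpoly k) y * x ^ k))"
    unfolding bpoly_sum m_def n_def u_def v_def
    by (simp add: algebra_simps power_numeral_reduce)
  ultimately have "16000000 * (x ^ 5 + (\<Sum>k=0..4. poly (bpoly k) y * x ^ k)) = 0"
    by (simp only:)
  thus ?thesis unfolding mult_eq_0_iff by simp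
qed

section \<open>Eta quotients and the function x\<close>

text \<open>The function x in terms of the nome, where passing from \<tau> to 5\<tau> becomes q ->
  q^5.\<close>

definition eta_quotient :: "complex \<Rightarrow> complex" where
  "eta_quotient q = euler (q ^ 2) ^ 5 * euler (q ^ 5) / (euler q ^ 5 * euler (q ^ 10))"

text \<open>Suitably scaled, the two level 10 identities read 1 = W - 4Y and X = Y + W, whence 4X +
  1 = 5W.\<close>

lemma eta_quotient_theta4:
  assumes q: "norm q < 1" "q \<noteq> 0"
  shows "4 * eta_quotient q + 1 = 5 * theta4 (q ^ 5) ^ 2 / theta4 q ^ 2"
proof -
  have q2: "norm (q ^ 2) < 1" and q5: "norm (q ^ 5) < 1" and q10: "norm (q ^ 10) < 1"
    using norm_power_less_one[OF q(1)] by auto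
  define E1 E2 E5 E10 where "E1 = euler q" and "E2 = euler (q ^ 2)"
    and "E5 = euler (q ^ 5)" and "E10 = euler (q ^ 10)"
  note E = E1_def[symmetric] E2_def[symmetric] E5_def[symmetric] E10_def[symmetric]
  have nz: "E1 \<noteq> 0" "E2 \<noteq> 0" "E5 \<noteq> 0" "E10 \<noteq> 0"
    unfolding E1_def E2_def E5_def E10_def by (intro euler_nonzero q q2 q5 q10)+
  have q52: "(q ^ 5) ^ 2 = q ^ 10" by simp
  \<comment> \<open>X is the eta quotient, W = theta4(q^5)^2 / theta4(q)^2, and Y is the product y
    with X = 1 + 5Y.\<close>
  define Y W X where "Y = q * E2 * E10 ^ 3 / (E1 ^ 3 * E5)" and "W = E5 ^ 4 * E2 ^ 2 / (E10 ^ 2 * E1 ^ 4)"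
    and "X = E2 ^ 5 * E5 / (E1 ^ 5 * E10)"
  have "(E1 ^ 2 / E2) ^ 2 = (E5 ^ 2 / E10) ^ 2 - 4 * q * E10 ^ 3 * E1 / (E2 * E5)"
    using theta4_identity[OF q] unfolding theta4_def q52 E .
  hence "(E1 ^ 2 / E2) ^ 2 * (E2 ^ 2 / E1 ^ 4) =
         ((E5 ^ 2 / E10) ^ 2 - 4 * q * E10 ^ 3 * E1 / (E2 * E5)) * (E2 ^ 2 / E1 ^ 4)" by (simp only:)
  moreover have "(E1 ^ 2 / E2) ^ 2 * (E2 ^ 2 / E1 ^ 4) = 1"
    using nz by (simp add: field_simps power_numeral_reduce)
  moreover have "((E5 ^ 2 / E10) ^ 2 - 4 * q * E10 ^ 3 * E1 / (E2 * E5)) * (E2 ^ 2 / E1 ^ 4) = W - 4 * Y"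
    using nz by (simp add: W_def Y_def field_simps power_numeral_reduce)
  ultimately have 1: "1 = W - 4 * Y" by (simp only:)
  have "(E2 ^ 2 / E1) ^ 2 = q * (E10 ^ 2 / E5) ^ 2 + E2 * E5 ^ 3 / (E1 * E10)"
    using psi_identity[OF q] unfolding psi_def q52 E .
  \<comment> \<open>The multiplier is the quotient of X by \<open>psi q ^ 2\<close>; for the first
    identity it was the inverse of \<open>theta4 q ^ 2\<close>.\<close>
  hence "(E2 ^ 2 / E1) ^ 2 * (E2 * E5 / (E1 ^ 3 * E10)) =
         (q * (E10 ^ 2 / E5) ^ 2 + E2 * E5 ^ 3 / (E1 * E10)) * (E2 * E5 / (E1 ^ 3 * E10))" by (simp only:)
  moreover have "(E2 ^ 2 / E1) ^ 2 * (E2 * E5 / (E1 ^ 3 * E10)) = X"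
    using nz by (simp add: X_def field_simps power_numeral_reduce)
  moreover have "(q * (E10 ^ 2 / E5) ^ 2 + E2 * E5 ^ 3 / (E1 * E10)) * (E2 * E5 / (E1 ^ 3 * E10)) = Y + W"
    using nz by (simp add: W_def Y_def field_simps power_numeral_reduce)
  ultimately have 2: "X = Y + W" by (simp only:)
  have "5 * theta4 (q ^ 5) ^ 2 / theta4 q ^ 2 = 5 * W"
    unfolding theta4_def q52 E using nz by (simp add: W_def field_simps power_numeral_reduce)
  moreover have "eta_quotient q = X" unfolding eta_quotient_def X_def E ..
  ultimately show ?thesis using 1 2 by (simp add: algebra_simps)
qed

lemma theta4_nonzero:
  assumes "norm q < 1"
  shows "theta4 q \<noteq> 0"
  using euler_nonzero[OF assms] euler_nonzero[OF norm_power_less_one[OF assms, of 2]]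
  by (simp add: theta4_def)

text \<open>Divide the square of \<open>euler_root_prod\<close> for q and z by its instance for q^2
  and z^2; the square of z is again a nontrivial fifth root of unity.\<close>

lemma theta4_root_prod:
  assumes q: "norm q < 1" and z: "z ^ 5 = 1" "z \<noteq> 1"
  shows "(\<Prod>j<5. theta4 (z ^ j * q)) * theta4 (q ^ 25) = theta4 (q ^ 5) ^ 6"
proof -
  have q2: "norm (q ^ 2) < 1" by (rule norm_power_less_one[OF q]) simp
  have z2: "(z ^ 2) ^ 5 = 1" "z ^ 2 \<noteq> 1" using fifth_root_power[OF z, of 2] by auto
  have "(z ^ j * q) ^ 2 = (z ^ 2) ^ j * q ^ 2" for j
    by (simp add: power_mult_distrib mult.commute flip: power_mult)
  hence "(\<Prod>j<5. theta4 (z ^ j * q)) =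
      (\<Prod>j<5. euler (z ^ j * q)) ^ 2 / (\<Prod>j<5. euler ((z ^ 2) ^ j * q ^ 2))"
    by (simp only: theta4_def prod_dividef prod_power_distrib)
  hence "(\<Prod>j<5. theta4 (z ^ j * q)) * theta4 (q ^ 25) =
      ((\<Prod>j<5. euler (z ^ j * q)) * euler (q ^ 25)) ^ 2 /
      ((\<Prod>j<5. euler ((z ^ 2) ^ j * q ^ 2)) * euler ((q ^ 2) ^ 25))"
    by (simp add: theta4_def power_mult_distrib flip: power_mult)
  also have "\<dots> = (euler (q ^ 5) ^ 6) ^ 2 / euler ((q ^ 2) ^ 5) ^ 6"
    unfolding euler_root_prod[OF q z] euler_root_prod[OF q2 z2] ..
  finally show ?thesis by (simp add: theta4_def power_divide flip: power_mult)
qed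

text \<open>All inputs of the elimination come from the alternating series: the dissection, its
  square, and the product over rotations. The formula for x is used at q and at q^5.\<close>

lemma modular_equation_eta_quotient:
  assumes q: "norm q < 1" "q \<noteq> 0"
  shows "eta_quotient q ^ 5 + (\<Sum>k=0..4. poly (bpoly k) (eta_quotient (q ^ 5)) * eta_quotient q ^ k) = 0"
proof -
  define z where "z = exp (2 * of_real pi * \<i> / 5)"
  have "z ^ 5 = exp (of_nat 5 * (2 * of_real pi * \<i> / 5))"
    unfolding z_def by (rule exp_of_nat_mult[symmetric])
  also have "of_nat 5 * (2 * of_real pi * \<i> / 5) = 2 * of_real pi * \<i>" by simp
  also have "exp \<dots> = 1" by (rule exp_two_pi_i)
  finally have z5: "z ^ 5 = 1" .
  have z_ne: "z \<noteq> 1"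
  proof
    assume "z = 1"
    then obtain n :: int where "2 * pi / 5 = of_int (2 * n) * pi"
      unfolding z_def exp_eq_1 by auto
    hence "of_int (5 * n) = (of_int 1 :: real)" by simp
    hence "5 * n = 1" by (simp only: of_int_eq_iff)
    thus False by presburger
  qed
  note z = z5 z_ne
  define \<alpha> \<beta> where "\<alpha> = 2 * alternating.part 1 q" and "\<beta> = 2 * alternating.part 2 q"
  have z1: "norm z = 1" using power_eq_1_iff[OF z(1)] by simp
  have powers: "norm (q ^ k) < 1" "q ^ k \<noteq> 0" if "k > 0" for k
    using norm_power_less_one[OF q(1) that] q(2) by auto
  have part_0: "alternating.part 0 q = theta4 (q ^ 25)"
    using alternating.part_0[OF q] alternating_theta[OF powers] by simp
  \<comment> \<open>The classes 1 and 2 mod 5 have squares 1 and 4, so \<alpha> picks up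
    \<open>z ^ j\<close> and \<beta> picks up its fourth power, while the class 0 is fixed.\<close>
  have rotate: "theta4 (z ^ j * q) = theta4 (q ^ 25) + z ^ j * \<alpha> + z ^ (4 * j) * \<beta>" for j
  proof -
    have j: "norm (z ^ j * q) < 1" "z ^ j * q \<noteq> 0" using q z1 by (auto simp: norm_mult norm_power)
    have "(z ^ j) ^ 5 = (z ^ 5) ^ j" by (simp only: power_mult[symmetric] mult.commute)
    hence zj: "(z ^ j) ^ 5 = 1" by (simp only: z(1) power_one)
    have "(z ^ j) ^ 4 = z ^ (4 * j)" by (simp only: power_mult[symmetric] mult.commute)
    hence part_rotate: "alternating.part 0 (z ^ j * q) = alternating.part 0 q"
        "alternating.part 1 (z ^ j * q) = z ^ j * alternating.part 1 q"
        "alternating.part 2 (z ^ j * q) = z ^ (4 * j) * alternating.part 2 q"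
      using alternating.part_rotate[OF zj, of 0 q] alternating.part_rotate[OF zj, of 1 q]
        alternating.part_rotate[OF zj, of 2 q] by simp_all
    show ?thesis
      unfolding alternating_theta[OF j, symmetric] alternating.theta_dissection[OF j]
      unfolding part_rotate part_0 \<alpha>_def \<beta>_def by (simp only: mult.left_commute)
  qed
  have a: "theta4 q = theta4 (q ^ 25) + \<alpha> + \<beta>" using rotate[of 0] by simp
  have b: "theta4 (q ^ 5) ^ 2 = theta4 (q ^ 25) ^ 2 + \<alpha> * \<beta>"
    using alternating.theta_square[OF q] alternating_theta[OF powers, of 5]
    by (simp add: part_0 \<alpha>_def \<beta>_def)
  have c: "(theta4 (q ^ 25) ^ 5 + \<alpha> ^ 5 + \<beta> ^ 5 - 5 * theta4 (q ^ 25) ^ 3 * (\<alpha> * \<beta>) +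
      5 * theta4 (q ^ 25) * (\<alpha> * \<beta>) ^ 2) * theta4 (q ^ 25) = theta4 (q ^ 5) ^ 6"
    using theta4_root_prod[OF q(1) z] unfolding rotate fifth_root_prod[OF z] .
  show ?thesis
  proof (rule modular_relation_from_theta_relation[OF _ _ a b c])
    show "theta4 q \<noteq> 0" "theta4 (q ^ 5) \<noteq> 0" using theta4_nonzero q(1) powers[of 5] by auto
    show "4 * eta_quotient q + 1 = 5 * theta4 (q ^ 5) ^ 2 / theta4 q ^ 2"
      by (rule eta_quotient_theta4[OF q])
    show "4 * eta_quotient (q ^ 5) + 1 = 5 * theta4 (q ^ 25) ^ 2 / theta4 (q ^ 5) ^ 2"
      using eta_quotient_theta4[OF powers, of 5] by (simp flip: power_mult)
  qed
qed

lemma xfun_eq_eta_quotient: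
  assumes "Im \<tau> > 0"
  shows "xfun \<tau> = eta_quotient (nome \<tau>)"
proof -
  define q where "q = nome \<tau>"
  have q: "norm q < 1" using assms by (simp add: q_def nome_def)
  have conv: "convergent_prod (\<lambda>m. 1 - q ^ (k * Suc m))"
    and euler: "(\<Prod>m. 1 - q ^ (k * Suc m)) = euler (q ^ k)" if "k > 0" for k
  proof -
    have eq: "(\<lambda>m. 1 - q ^ (k * Suc m)) = (\<lambda>m. 1 - q ^ k * (q ^ k) ^ m)"
      by (simp add: power_add power_mult)
    show "convergent_prod (\<lambda>m. 1 - q ^ (k * Suc m))"
      unfolding eq by (rule convergent_prod_qpoch[OF norm_power_less_one[OF q that]])
    show "(\<Prod>m. 1 - q ^ (k * Suc m)) = euler (q ^ k)"
      unfolding eq euler_def qpoch_def ..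
  qed
  \<comment> \<open>The exponent is written \<open>1 * Suc m\<close> so that \<open>conv\<close> and
    \<open>euler\<close> apply to all four products, with k = 1, 2, 5, 10.\<close>
  have "xfun \<tau> = (\<Prod>m. ((1 - q ^ (2 * Suc m)) ^ 5 * (1 - q ^ (5 * Suc m))) /
           ((1 - q ^ (1 * Suc m)) ^ 5 * (1 - q ^ (10 * Suc m))))"
    by (simp add: xfun_def q_def Let_def)
  also have "\<dots> = (\<Prod>m. (1 - q ^ (2 * Suc m)) ^ 5 * (1 - q ^ (5 * Suc m))) /
           (\<Prod>m. (1 - q ^ (1 * Suc m)) ^ 5 * (1 - q ^ (10 * Suc m)))"
    by (intro prodinf_divide[symmetric] convergent_prod_mult convergent_prod_power conv) simp_all
  also have "\<dots> = ((\<Prod>m. 1 - q ^ (2 * Suc m)) ^ 5 * (\<Prod>m. 1 - q ^ (5 * Suc m))) /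
           ((\<Prod>m. 1 - q ^ (1 * Suc m)) ^ 5 * (\<Prod>m. 1 - q ^ (10 * Suc m)))"
    by (subst prodinf_mult[symmetric], (intro convergent_prod_power conv; simp)+)+
       (simp only: prodinf_power conv zero_less_numeral zero_less_one)
  also have "\<dots> = eta_quotient q"
    by (simp only: euler zero_less_numeral zero_less_one power_one_right eta_quotient_def)
  finally show ?thesis by (simp add: q_def)
qed

theorem theorem2p5:
  fixes \<tau> :: complex
  assumes "Im \<tau> > 0"
  shows "xfun \<tau> ^ 5 + (\<Sum>k=0..4. poly (bpoly k) (xfun (5 * \<tau>)) * xfun \<tau> ^ k) = 0"
proof -
  have "nome (5 * \<tau>) = nome \<tau> ^ 5"
    unfolding nome_def by (simp add: algebra_simps flip: exp_of_nat_mult)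
  moreover have "norm (nome \<tau>) < 1" "nome \<tau> \<noteq> 0" using assms by (simp_all add: nome_def)
  ultimately show ?thesis
    using modular_equation_eta_quotient[of "nome \<tau>"] xfun_eq_eta_quotient[of \<tau>]
      xfun_eq_eta_quotient[of "5 * \<tau>"] assms by simp
qed

end
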